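(* Let $r$ and $\Delta$ be positive integers with $r \geq 2$, and let $p$ be the smallest prime number with $\Delta < p$. Then, \[ g(\Delta,r) \leq \max\{r, p\} + 1. \] Furthermore, if $r,\Delta \geq 2$, then $g(\Delta,r) \leq 2\Delta$, and if $r \geq 2\Delta - 1$, then $g(\Delta,r) = r+1$.
   Context: A matrix $A \in \mathbb{Z}^{r \times n}$ is called generic if all its $\operatorname{rank}(A) \times \operatorname{rank}(A)$ minors are non-zero. It is called $\Delta$-modular if all its $\operatorname{rank}(A) \times \operatorname{rank}(A)$ minors are bounded by $\Delta$ in absolute value and at least one such minor equals $\Delta$ or $-\Delta$. Matrices are assumed to have no repeated columns. Define \[ g(\Delta,r) := \max\{ n : \exists \text{ a generic } \Delta\text{-modular } A \in \mathbb{Z}^{r \times n} \text{ with } \operatorname{rank}(A) = r\}. \]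
   Formalization: The bound g(Δ,r) ≤ 2Δ for r,Δ ≥ 2 is stated only for r ≤ 2Δ−1, since it fails for every r ≥ 2Δ: the matrix [I_r | (1,…,1,Δ)^T] gives g(Δ,r) ≥ r+1 > 2Δ (e.g. g(2,4) ≥ 5). *)

theory Defs
  imports
    Jordan_Normal_Form.DL_Rank
    Jordan_Normal_Form.DL_Submatrix
    "HOL-Computational_Algebra.Primes"
begin

(* The rank of an integer matrix is its rank over the field of rationals. *)
definition int_rank :: "int mat \<Rightarrow> nat" where
  "int_rank A = vec_space.rank (dim_row A) (map_mat rat_of_int A)"

definition minors :: "nat \<Rightarrow> int mat \<Rightarrow> int set" where
  "minors k A = {det (submatrix A I J) | I J.
     I \<subseteq> {..<dim_row A} \<and> J \<subseteq> {..<dim_col A} \<and> card I = k \<and> card J = k}"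

definition generic :: "int mat \<Rightarrow> bool" where
  "generic A \<longleftrightarrow> (\<forall>m \<in> minors (int_rank A) A. m \<noteq> 0)"

definition modular :: "nat \<Rightarrow> int mat \<Rightarrow> bool" where
  "modular \<Delta> A \<longleftrightarrow>
     (\<forall>m \<in> minors (int_rank A) A. \<bar>m\<bar> \<le> int \<Delta>) \<and>
     (\<exists>m \<in> minors (int_rank A) A. m = int \<Delta> \<or> m = - int \<Delta>)"

definition generic_modular_col_numbers :: "nat \<Rightarrow> nat \<Rightarrow> nat set" where
  "generic_modular_col_numbers \<Delta> r = {n. \<exists>A \<in> carrier_mat r n.
     distinct (cols A) \<and> generic A \<and> modular \<Delta> A \<and> int_rank A = r}"

(* Max is unspecified on an infinite set, so any estimate of g entails showing
   that the set of attainable column numbers is finite. *)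
definition g :: "nat \<Rightarrow> nat \<Rightarrow> nat" where
  "g \<Delta> r = Max (generic_modular_col_numbers \<Delta> r)"

end

(* Modulo the prime p > \<Delta> all maximal minors of a generic \<Delta>-modular matrix are non-zero, so its columns
   form an arc and the bound max r p + 1 is the prime case of Ball's theorem on arcs (MDS codes).

   Only the three-term Pluecker relations between the maximal minors m(J) are needed. Fixing a set A of
   r - 2 columns, they make the remaining columns pairwise independent vectors in a plane over F_p. There,
   a product of linear forms killing the missing directions has, on the given vectors, values that are
   known by Wilson's theorem, and Lagrange interpolation turns this into a linear relation between
   explicit units indexed by the (r - 1)-sets containing A. If there are p + 2 columns, the relations for
   all A inside a set of 2r - 3 columns have only the zero solution, because r - 1 < p. Complementation of
   J preserves the Pluecker relations and covers the remaining ranks.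

   The bound 2 \<Delta> then follows from Bertrand's postulate, proved by Erdos' method, and the lower bound
   r + 1 from the matrix [I | (1, ..., 1, \<Delta>)]. *)
theory Submission
  imports Defs
    "HOL-Number_Theory.Residues"
    "HOL.Binomial_Plus"
    "Jordan_Normal_Form.DL_Rank_Submatrix"
begin

section \<open>Vectors in a plane modulo a prime\<close>

text \<open>The number 2r - 3 is forced from two sides. For a set A of r - 2 columns, the other p +
  4 - r among p + 2 columns take up that many of the p + 1 directions of the plane. So r - 3
  directions are missing, and interpolating a product of r - 3 linear forms needs r - 1 nodes; A and
  the nodes together are 2r - 3 columns. The nodes have to come from one fixed set for all A, since
  only then do the relations for different A share their unknowns. On the other hand, two (r -
  1)-sets inside 2r - 3 columns always meet. This starts a recursion over the size of the
  intersection with a given (r - 1)-set, whose divisors are 1, ..., r - 1; hence the condition r - 1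
  < p. The 2r - 3 columns exist among p + 2 only if 2r \<le> p + 5, and for r \<le> p it is the
  larger r that pass to the complementary rank p + 2 - r. If r > p, complementation inside r + 2
  columns leads to rank 2, where at most p + 1 directions are available.\<close>

datatype ivec = IVec (fst_coord: int) (snd_coord: int)

fun area :: "ivec \<Rightarrow> ivec \<Rightarrow> int" where
  "area (IVec a b) (IVec c d) = a * d - b * c"

lemma area_swap: "area u v = - area v u"
  by (cases u; cases v) simp

lemma area_self [simp]: "area u u = 0"
  by (cases u) simp

text \<open>The three-term relation of the plane, read as an expansion: the linear form with zero
  \<open>w\<close> is a combination of the forms with zeros \<open>z\<close> and
  \<open>y\<close>.\<close>

lemma area_plucker: "area a w * area y z = area y w * area a z - area z w * area a y"
  by (cases a; cases w; cases y; cases z) (simp add: algebra_simps)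

locale prime_modulus =
  fixes p :: nat
  assumes prime_p: "prime p"
begin

section \<open>Units and inverses modulo a prime\<close>

definition unit :: "int \<Rightarrow> bool" where
  "unit x \<longleftrightarrow> \<not> int p dvd x"

text \<open>Inverse modulo \<open>p\<close> by Fermat's theorem; as a power it is multiplicative on the nose.\<close>

definition rcp :: "int \<Rightarrow> int" where
  "rcp x = x ^ (p - 2)"

lemma unit_mult [simp]: "unit (x * y) \<longleftrightarrow> unit x \<and> unit y"
  using prime_p by (simp add: unit_def prime_dvd_mult_iff)

lemma unit_one [simp]: "unit 1"
  using prime_p by (auto simp: unit_def)

lemma unit_uminus [simp]: "unit (- x) \<longleftrightarrow> unit x"
  by (simp add: unit_def)

lemma unit_nonzero: "unit x \<Longrightarrow> x \<noteq> 0"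
  by (auto simp: unit_def)

lemma unit_power: "unit x \<Longrightarrow> unit (x ^ n)"
  by (induction n) auto

lemma unit_prod: "(\<And>i. i \<in> A \<Longrightarrow> unit (f i)) \<Longrightarrow> unit (prod f A)"
  by (induction A rule: infinite_finite_induct) auto

lemma unit_cong: "[x = y] (mod int p) \<Longrightarrow> unit x \<longleftrightarrow> unit y"
  by (simp add: unit_def cong_dvd_iff)

lemma unit_rcp [simp]: "unit x \<Longrightarrow> unit (rcp x)"
  by (simp add: rcp_def unit_power)

lemma rcp_mult: "rcp (x * y) = rcp x * rcp y"
  by (simp add: rcp_def power_mult_distrib)

lemma cong_fermat: assumes "unit x" shows "[x ^ (p - 1) = 1] (mod int p)"
proof -
  define y where "y = nat (x mod int p)"
  have p0: "p > 0" using prime_p prime_gt_0_nat by blast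
  have y: "int y = x mod int p" using p0 by (simp add: y_def)
  have xy: "[x = int y] (mod int p)" by (simp add: y cong_def)
  have "\<not> p dvd y"
    using assms unit_cong[OF xy] by (simp add: unit_def)
  then have "[y ^ (p - 1) = 1] (mod p)" by (rule fermat_theorem[OF prime_p])
  then have "[int y ^ (p - 1) = 1] (mod int p)"
    using cong_int_iff[of "y ^ (p - 1)" 1 p] by simp
  then show ?thesis by (rule cong_trans[OF cong_pow[OF xy]])
qed

lemma mult_rcp: assumes "unit x" shows "[x * rcp x = 1] (mod int p)"
proof -
  have p2: "p \<ge> 2" using prime_p by (rule prime_ge_2_nat)
  have "[x ^ (p - 1) = 1] (mod int p)"
    using cong_fermat assms by blast
  moreover have "x * rcp x = x ^ (p - 1)"
    using p2 le_Suc_ex[OF p2] by (auto simp: rcp_def)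
  ultimately show ?thesis by simp
qed

lemma cong_unit_cancel:
  assumes "unit k" "[k * x = k * y] (mod int p)" shows "[x = y] (mod int p)"
proof -
  have "coprime k (int p)"
    using assms(1) prime_p prime_imp_coprime[of "int p" k] by (simp add: unit_def coprime_commute)
  then show ?thesis
    using assms(2) by (simp add: cong_mult_lcancel)
qed

lemma rcp_unique: assumes "[x * y = 1] (mod int p)" shows "[y = rcp x] (mod int p)"
proof -
  have "unit x" using unit_cong[OF assms] by simp
  show ?thesis
  proof (rule cong_unit_cancel[OF \<open>unit x\<close>])
    show "[x * y = x * rcp x] (mod int p)"
      using assms mult_rcp[OF \<open>unit x\<close>] unfolding cong_def by (simp only:)
  qed
qed

lemma rcp_neg_one: "[rcp (- 1) = - 1] (mod int p)"
  using rcp_unique[of "-1" "-1"] by (simp add: cong_sym)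

section \<open>Lagrange interpolation on pairwise independent vectors\<close>

definition spread :: "ivec set \<Rightarrow> bool" where
  "spread V \<longleftrightarrow> finite V \<and> (\<forall>u\<in>V. \<forall>v\<in>V. u \<noteq> v \<longrightarrow> unit (area u v))"

lemma spread_unit: "spread V \<Longrightarrow> u \<in> V \<Longrightarrow> v \<in> V \<Longrightarrow> u \<noteq> v \<Longrightarrow> unit (area u v)"
  by (simp add: spread_def)

lemma spread_subset: "spread V \<Longrightarrow> U \<subseteq> V \<Longrightarrow> spread U"
  unfolding spread_def by (meson finite_subset subsetD)

text \<open>A form that vanishes at a node removes this node: the summand at \<open>z\<close> is
  zero, and elsewhere the factor \<open>area a z\<close> cancels one factor of the
  denominator.\<close>

lemma interpolation_step:
  assumes E: "spread E" and z: "z \<in> E"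
  shows "[(\<Sum>a\<in>E. (area a z * f a) * rcp (\<Prod>e\<in>E-{a}. area a e))
        = (\<Sum>a\<in>E-{z}. f a * rcp (\<Prod>e\<in>E-{z}-{a}. area a e))] (mod int p)"
proof -
  have fin: "finite E" using E by (simp add: spread_def)
  have "(\<Sum>a\<in>E. (area a z * f a) * rcp (\<Prod>e\<in>E-{a}. area a e))
      = (\<Sum>a\<in>E-{z}. (area a z * f a) * rcp (\<Prod>e\<in>E-{a}. area a e))"
    by (subst sum.remove[OF fin z]) simp
  also have "[\<dots> = (\<Sum>a\<in>E-{z}. f a * rcp (\<Prod>e\<in>E-{z}-{a}. area a e))] (mod int p)"
  proof (rule cong_sum)
    fix a assume a: "a \<in> E - {z}"
    have "unit (area a z)" using spread_unit[OF E] a z by auto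
    have zin: "z \<in> E - {a}" using a z by auto
    have "(\<Prod>e\<in>E-{a}. area a e) = area a z * (\<Prod>e\<in>E-{a}-{z}. area a e)"
      using fin zin by (subst prod.remove[of _ z]) auto
    moreover have "E - {a} - {z} = E - {z} - {a}" by auto
    ultimately have "(area a z * f a) * rcp (\<Prod>e\<in>E-{a}. area a e)
        = (area a z * rcp (area a z)) * (f a * rcp (\<Prod>e\<in>E-{z}-{a}. area a e))"
      by (simp add: rcp_mult mult_ac)
    also have "[\<dots> = 1 * (f a * rcp (\<Prod>e\<in>E-{z}-{a}. area a e))] (mod int p)"
      by (rule cong_mult[OF mult_rcp[OF \<open>unit (area a z)\<close>] cong_refl])
    finally show "[(area a z * f a) * rcp (\<Prod>e\<in>E-{a}. area a e)
        = f a * rcp (\<Prod>e\<in>E-{z}-{a}. area a e)] (mod int p)"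
      by simp
  qed
  finally show ?thesis .
qed

text \<open>Homogeneous version of the fact that a divided difference with \<open>card E\<close>
  nodes kills polynomials of degree \<open>card E - 2\<close>. In the induction,
  \<open>area_plucker\<close> writes one form through two forms that vanish at nodes
  \<open>y\<close> and \<open>z\<close>, and each of these removes a node.\<close>

lemma interpolation:
  assumes "spread E" "finite W" "card E = card W + 2"
  shows "[(\<Sum>a\<in>E. (\<Prod>w\<in>W. area a w) * rcp (\<Prod>e\<in>E-{a}. area a e)) = 0] (mod int p)"
  using assms(2,1,3)
proof (induction W arbitrary: E rule: finite_induct)
  case empty
  then obtain x y where E: "E = {x, y}" "x \<noteq> y"
    by (auto simp: numeral_2_eq_2 card_Suc_eq)
  have 1: "{x, y} - {x} = {y}" "{x, y} - {y} = {x}" using E by auto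
  have "rcp (area y x) = rcp (- 1) * rcp (area x y)"
    by (subst area_swap) (simp flip: rcp_mult)
  moreover have "[rcp (area x y) + rcp (- 1) * rcp (area x y)
      = rcp (area x y) + (- 1) * rcp (area x y)] (mod int p)"
    by (intro cong_add cong_mult cong_refl rcp_neg_one)
  ultimately show ?case using E 1 by simp
next
  case (insert w W)
  have "card E \<ge> 2" using insert by simp
  then obtain y z where yz: "y \<in> E" "z \<in> E" "y \<noteq> z"
    using card_le_Suc0_iff_eq[of E] insert.prems(1) by (auto simp: spread_def)
  let ?R = "\<lambda>a. rcp (\<Prod>e\<in>E-{a}. area a e)"
  let ?f = "\<lambda>a. \<Prod>w\<in>W. area a w"
  let ?S = "\<lambda>z. \<Sum>a\<in>E. (area a z * ?f a) * ?R a"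
  have IH: "[?S z = 0] (mod int p)" if "z \<in> E" for z
  proof -
    have "[(\<Sum>a\<in>E-{z}. ?f a * rcp (\<Prod>e\<in>E-{z}-{a}. area a e)) = 0] (mod int p)"
    proof (rule insert.IH)
      show "spread (E - {z})" by (rule spread_subset[OF insert.prems(1)]) auto
      show "card (E - {z}) = card W + 2"
        using insert.prems(2) insert.hyps that by (simp add: card_Diff_singleton)
    qed
    then show ?thesis
      by (rule cong_trans[OF interpolation_step[OF insert.prems(1) that]])
  qed
  have "area y z * (\<Sum>a\<in>E. (\<Prod>w\<in>insert w W. area a w) * ?R a)
      = (\<Sum>a\<in>E. (area a w * area y z) * (?f a * ?R a))"
    unfolding sum_distrib_left using insert.hyps by (intro sum.cong) (simp_all add: mult_ac)
  also have "\<dots> = area y w * ?S z - area z w * ?S y"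
    unfolding area_plucker[of _ w y z] sum_distrib_left sum_subtractf[symmetric]
    by (intro sum.cong) (simp_all add: algebra_simps)
  also have "[\<dots> = area y w * 0 - area z w * 0] (mod int p)"
    by (intro cong_diff cong_mult cong_refl IH yz)
  finally have "[area y z * (\<Sum>a\<in>E. (\<Prod>w\<in>insert w W. area a w) * ?R a) = area y z * 0] (mod int p)"
    by simp
  then show ?case
    by (rule cong_unit_cancel[OF spread_unit[OF insert.prems(1) yz]])
qed

text \<open>A coordinate on the projective line with \<open>x\<close> at 0 and \<open>y\<close> at
  infinity. The reduction modulo \<open>p\<close> yields canonical representatives, so that values
  can be counted inside \<open>{1..<int p}\<close>.\<close>

definition ratio :: "ivec \<Rightarrow> ivec \<Rightarrow> ivec \<Rightarrow> int" where
  "ratio x y v = (area x v * rcp (area y v)) mod int p"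

lemma ratio_cong: "[ratio x y v = area x v * rcp (area y v)] (mod int p)"
  by (simp add: ratio_def)

lemma ratio_mult:
  assumes "unit (area y v)" shows "[ratio x y v * area y v = area x v] (mod int p)"
proof -
  have "[ratio x y v * area y v = area x v * rcp (area y v) * area y v] (mod int p)"
    by (intro cong_mult ratio_cong cong_refl)
  moreover have "[area x v * (area y v * rcp (area y v)) = area x v * 1] (mod int p)"
    by (intro cong_mult mult_rcp assms cong_refl)
  moreover have "area x v * (area y v * rcp (area y v)) = area x v * rcp (area y v) * area y v"
    by (simp add: mult_ac)
  ultimately show ?thesis
    unfolding cong_def by (simp only: mult_1_right)
qed

lemma ratio_range:
  assumes "unit (area x v)" "unit (area y v)" shows "ratio x y v \<in> {1..<int p}"
proof -
  have p0: "int p > 0" using prime_p prime_gt_0_nat by simp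
  have "unit (ratio x y v)"
    using unit_cong[OF ratio_cong] assms by simp
  then have "ratio x y v \<noteq> 0" by (rule unit_nonzero)
  moreover have "0 \<le> ratio x y v" "ratio x y v < int p"
    using p0 by (simp_all add: ratio_def)
  ultimately show ?thesis by simp
qed

text \<open>Cross-multiplying two equal ratios leaves, by the three-term relation,
  \<open>area x y * area u v\<close> divisible by \<open>p\<close>.\<close>

lemma ratio_inj:
  assumes V: "spread V" and xy: "x \<in> V" "y \<in> V" "x \<noteq> y"
  shows "inj_on (ratio x y) (V - {x, y})"
proof (rule inj_onI, rule ccontr)
  fix u v assume uv: "u \<in> V - {x, y}" "v \<in> V - {x, y}" "ratio x y u = ratio x y v" "u \<noteq> v"
  have un: "unit (area y u)" "unit (area y v)" "unit (area x y)" "unit (area u v)"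
    using uv xy spread_unit[OF V] by auto
  have "[(ratio x y u * area y u) * area y v = area x u * area y v] (mod int p)"
    by (intro cong_mult ratio_mult un cong_refl)
  moreover have "[(ratio x y v * area y v) * area y u = area x v * area y u] (mod int p)"
    by (intro cong_mult ratio_mult un cong_refl)
  moreover have "(ratio x y u * area y u) * area y v = (ratio x y v * area y v) * area y u"
    using uv by simp
  ultimately have "[area x u * area y v = area x v * area y u] (mod int p)"
    unfolding cong_def by (simp only:)
  then have "int p dvd area x u * area y v - area x v * area y u"
    by (simp add: cong_iff_dvd_diff)
  moreover have "area x u * area y v - area x v * area y u = area x y * area u v"
    by (cases x; cases u; cases y; cases v) (simp add: algebra_simps)
  ultimately have "\<not> unit (area x y * area u v)"
    by (simp add: unit_def)
  then show False using un by simp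
qed

lemma ratio_image:
  assumes V: "spread V" and xy: "x \<in> V" "y \<in> V"
  shows "ratio x y ` (V - {x, y}) \<subseteq> {1..<int p}"
proof (rule image_subsetI)
  fix v assume "v \<in> V - {x, y}"
  then show "ratio x y v \<in> {1..<int p}"
    using spread_unit[OF V xy(1)] spread_unit[OF V xy(2)] by (intro ratio_range) auto
qed

lemma card_ratio_image:
  assumes V: "spread V" and xy: "x \<in> V" "y \<in> V" "x \<noteq> y"
  shows "card (ratio x y ` (V - {x, y})) = card V - 2"
  using card_image[OF ratio_inj[OF assms]] xy by (simp add: card_Diff_subset)

lemma spread_two_elements:
  assumes "spread V" "card V \<ge> 2"
  obtains x y where "x \<in> V" "y \<in> V" "x \<noteq> y"
  using card_le_Suc0_iff_eq[of V] assms by (auto simp: spread_def)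

lemma card_spread_le:
  assumes "spread V" shows "card V \<le> p + 1"
proof (cases "card V \<ge> 2")
  case True
  then obtain x y where xy: "x \<in> V" "y \<in> V" "x \<noteq> y"
    using spread_two_elements assms by blast
  have "card V - 2 \<le> card {1..<int p}"
    using card_mono[OF _ ratio_image[OF assms xy(1,2)]] card_ratio_image[OF assms xy] by simp
  then show ?thesis using prime_gt_0_nat[OF prime_p] by simp
qed simp

text \<open>A nonzero residue \<open>w\<close> that is not the \<open>ratio\<close> of any vector
  marks a free point of the projective line, and \<open>x - w * y\<close> is a vector with this
  coordinate.\<close>

lemma spread_extend_step:
  assumes V: "spread V" and c: "card V \<ge> 2" "card V \<le> p"
  shows "\<exists>u. u \<notin> V \<and> spread (insert u V)"
proof -
  obtain x y where xy: "x \<in> V" "y \<in> V" "x \<noteq> y"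
    using spread_two_elements V c by blast
  have "card (ratio x y ` (V - {x, y})) < card {1..<int p}"
    using card_ratio_image[OF V xy] c prime_gt_0_nat[OF prime_p] by simp
  moreover have "finite (ratio x y ` (V - {x, y}))"
    using V by (simp add: spread_def)
  ultimately have "\<not> {1..<int p} \<subseteq> ratio x y ` (V - {x, y})"
    by (meson card_mono not_less)
  then obtain w where w: "w \<in> {1..<int p}" "w \<notin> ratio x y ` (V - {x, y})"
    by blast
  define u where "u = IVec (fst_coord x - w * fst_coord y) (snd_coord x - w * snd_coord y)"
  have area_u: "area v u = area v x - w * area v y" for v
    by (cases x; cases y; cases v) (simp add: u_def algebra_simps)
  have "unit w" using w by (auto simp: unit_def dest: zdvd_imp_le)
  have uxy: "unit (area x y)" using spread_unit[OF V xy] .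
  have 1: "unit (area v u)" if v: "v \<in> V" for v
  proof -
    consider "v = x" | "v = y" | "v \<in> V - {x, y}" using v by auto
    then show ?thesis
    proof cases
      case 1
      then show ?thesis using \<open>unit w\<close> uxy by (simp add: area_u)
    next
      case 2
      then show ?thesis using uxy by (simp add: area_u area_swap[of y x])
    next
      case 3
      have un: "unit (area y v)" using spread_unit[OF V xy(2) v] 3 by auto
      show ?thesis
      proof (rule ccontr)
        assume "\<not> unit (area v u)"
        then have "int p dvd w * area y v - area x v"
          by (simp add: unit_def area_u area_swap[of v])
        then have "[w * area y v = area x v] (mod int p)"
          by (simp add: cong_iff_dvd_diff)
        then have "[w * area y v = ratio x y v * area y v] (mod int p)"
          by (rule cong_trans[OF _ cong_sym[OF ratio_mult[OF un]]])
        then have "[w = ratio x y v] (mod int p)"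
          using cong_unit_cancel[OF un, of w "ratio x y v"] by (simp add: mult.commute)
        then have "w = ratio x y v"
          using w ratio_image[OF V xy(1,2)] 3 by (intro cong_less_imp_eq_int[of w p]) auto
        then show False using w 3 by auto
      qed
    qed
  qed
  have "u \<notin> V" using 1[of u] by (auto simp: unit_def)
  moreover have "unit (area u v)" if "v \<in> V" for v
    using 1[OF that] by (subst area_swap) simp
  ultimately show ?thesis
    using V 1 by (auto simp: spread_def)
qed

lemma spread_extend:
  assumes "spread V" "card V \<ge> 2"
  shows "\<exists>U. V \<subseteq> U \<and> spread U \<and> card U = p + 1"
  using assms
proof (induction "p + 1 - card V" arbitrary: V)
  case 0
  then show ?case using card_spread_le[of V] by (intro exI[of _ V]) simp
next
  case (Suc n)
  then have "card V \<le> p" by simp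
  then obtain u where u: "u \<notin> V" "spread (insert u V)"
    using spread_extend_step[of V] Suc.prems by blast
  moreover have "card (insert u V) = Suc (card V)"
    using Suc.prems(1) u by (simp add: spread_def)
  ultimately have "\<exists>U. insert u V \<subseteq> U \<and> spread U \<and> card U = p + 1"
    using Suc(2,4) by (intro Suc(1)) simp_all
  then show ?case by (elim exE) auto
qed

text \<open>Once all directions occur, the ratios of the vectors other than \<open>x\<close> and
  \<open>y\<close> run through all nonzero residues. By Wilson's theorem the two products over
  \<open>V - {x, y}\<close> then differ by the factor -1, and so do the remaining factors
  \<open>area x y\<close> and \<open>area y x\<close>.\<close>

lemma prod_area_const:
  assumes V: "spread V" and c: "card V = p + 1" and x: "x \<in> V" and y: "y \<in> V"
  shows "[(\<Prod>v\<in>V-{x}. area x v) = (\<Prod>v\<in>V-{y}. area y v)] (mod int p)"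
proof (cases "x = y")
  case False
  let ?V = "V - {x, y}"
  have fin: "finite V" using V by (simp add: spread_def)
  have p0: "p > 0" using prime_gt_0_nat[OF prime_p] .
  have sub: "ratio x y ` ?V \<subseteq> {1..<int p}" by (rule ratio_image[OF V x y])
  have im: "ratio x y ` ?V = {1..<int p}"
    using card_ratio_image[OF V x y False] c p0
    by (intro card_subset_eq sub) auto
  have "(\<Prod>v\<in>?V. ratio x y v) = \<Prod>{1..<int p}"
    using prod.reindex[OF ratio_inj[OF V x y False], of "\<lambda>i. i"] im by simp
  also have "\<dots> = (\<Prod>i\<in>{1..p-1}. int i)"
    using p0 by (intro prod.reindex_bij_witness[of _ int nat]) auto
  also have "\<dots> = fact (p - 1)" by (simp add: fact_prod)
  finally have "[(\<Prod>v\<in>?V. ratio x y v) = - 1] (mod int p)"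
    using wilson_theorem[OF prime_p] by simp
  then have "[(\<Prod>v\<in>?V. ratio x y v) * (\<Prod>v\<in>?V. area y v) = (- 1) * (\<Prod>v\<in>?V. area y v)] (mod int p)"
    by (intro cong_mult cong_refl)
  moreover have "[(\<Prod>v\<in>?V. ratio x y v * area y v) = (\<Prod>v\<in>?V. area x v)] (mod int p)"
    using spread_unit[OF V y] by (intro cong_prod ratio_mult) auto
  ultimately have "[(\<Prod>v\<in>?V. area x v) = - (\<Prod>v\<in>?V. area y v)] (mod int p)"
    unfolding cong_def prod.distrib by (simp only: mult_minus_left mult_1)
  then have "[area x y * (\<Prod>v\<in>?V. area x v) = area x y * - (\<Prod>v\<in>?V. area y v)] (mod int p)"
    by (intro cong_mult cong_refl)
  moreover have "(\<Prod>v\<in>V-{x}. area x v) = area x y * (\<Prod>v\<in>V-{x}-{y}. area x v)"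
    using fin y False by (intro prod.remove) auto
  moreover have "(\<Prod>v\<in>V-{y}. area y v) = area y x * (\<Prod>v\<in>V-{y}-{x}. area y v)"
    using fin x False by (intro prod.remove) auto
  moreover have "V-{x}-{y} = ?V" "V-{y}-{x} = ?V" by auto
  ultimately show ?thesis
    by (simp add: area_swap[of y x])
qed simp

text \<open>After completing \<open>T\<close> to all \<open>p + 1\<close> directions, the added set
  \<open>W\<close> has \<open>card E - 2\<close> elements, just the degree that interpolation on
  \<open>E\<close> allows. By \<open>prod_area_const\<close> the product of the forms of
  \<open>W\<close> at \<open>a\<close> is a constant divided by the product over
  \<open>T - {a}\<close>, so the added directions drop out of the relation.\<close>

lemma spread_sum_zero:
  assumes T: "spread T" and E: "E \<subseteq> T" "card E \<ge> 2" and c: "card T + card E = p + 3"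
  shows "[(\<Sum>a\<in>E. rcp ((\<Prod>s\<in>T-{a}. area a s) * (\<Prod>e\<in>E-{a}. area a e))) = 0] (mod int p)"
proof -
  have finT: "finite T" using T by (simp add: spread_def)
  have "card T \<ge> 2" using card_mono[OF finT E(1)] E(2) by simp
  then obtain U where U: "T \<subseteq> U" "spread U" "card U = p + 1"
    using spread_extend[OF T] by blast
  have finU: "finite U" using U by (simp add: spread_def)
  define W where "W = U - T"
  have W: "finite W" "card E = card W + 2"
    using c finT finU U card_mono[OF finT E(1)] E(2) by (auto simp: W_def card_Diff_subset)
  obtain x where x: "x \<in> E" using E(2) by (cases "E = {}") auto
  define k where "k = (\<Prod>v\<in>U-{x}. area x v)"
  have "unit k"
    unfolding k_def using x E U by (intro unit_prod spread_unit[OF U(2)]) auto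
  have *: "[(\<Prod>w\<in>W. area a w) = k * rcp (\<Prod>s\<in>T-{a}. area a s)] (mod int p)" if a: "a \<in> E" for a
  proof -
    have un: "unit (\<Prod>s\<in>T-{a}. area a s)"
      using a E by (intro unit_prod spread_unit[OF T]) auto
    have "(\<Prod>v\<in>U-{a}. area a v) = (\<Prod>w\<in>W. area a w) * (\<Prod>s\<in>T-{a}. area a s)"
    proof -
      have "U - {a} = W \<union> (T - {a})" "W \<inter> (T - {a}) = {}" using a E U by (auto simp: W_def)
      then show ?thesis using W finT by (simp add: prod.union_disjoint)
    qed
    moreover have "[(\<Prod>v\<in>U-{a}. area a v) = k] (mod int p)"
      unfolding k_def using a x E U by (intro prod_area_const U) auto
    ultimately have "[(\<Prod>w\<in>W. area a w) * (\<Prod>s\<in>T-{a}. area a s) * rcp (\<Prod>s\<in>T-{a}. area a s)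
        = k * rcp (\<Prod>s\<in>T-{a}. area a s)] (mod int p)"
      by (intro cong_mult) auto
    moreover have "[(\<Prod>w\<in>W. area a w) * ((\<Prod>s\<in>T-{a}. area a s) * rcp (\<Prod>s\<in>T-{a}. area a s))
        = (\<Prod>w\<in>W. area a w) * 1] (mod int p)"
      by (intro cong_mult mult_rcp un cong_refl)
    moreover have "(\<Prod>w\<in>W. area a w) * (\<Prod>s\<in>T-{a}. area a s) * rcp (\<Prod>s\<in>T-{a}. area a s)
        = (\<Prod>w\<in>W. area a w) * ((\<Prod>s\<in>T-{a}. area a s) * rcp (\<Prod>s\<in>T-{a}. area a s))"
      by (simp only: mult.assoc)
    ultimately show ?thesis
      unfolding cong_def by (simp only: mult_1_right)
  qed
  let ?S = "\<Sum>a\<in>E. rcp ((\<Prod>s\<in>T-{a}. area a s) * (\<Prod>e\<in>E-{a}. area a e))"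
  have "[(\<Sum>a\<in>E. (\<Prod>w\<in>W. area a w) * rcp (\<Prod>e\<in>E-{a}. area a e))
      = (\<Sum>a\<in>E. (k * rcp (\<Prod>s\<in>T-{a}. area a s)) * rcp (\<Prod>e\<in>E-{a}. area a e))] (mod int p)"
    by (intro cong_sum cong_mult * cong_refl)
  moreover have "[(\<Sum>a\<in>E. (\<Prod>w\<in>W. area a w) * rcp (\<Prod>e\<in>E-{a}. area a e)) = 0] (mod int p)"
    by (intro interpolation spread_subset[OF T] E W)
  moreover have "(\<Sum>a\<in>E. (k * rcp (\<Prod>s\<in>T-{a}. area a s)) * rcp (\<Prod>e\<in>E-{a}. area a e)) = k * ?S"
    by (simp add: rcp_mult sum_distrib_left mult_ac)
  ultimately have "[k * ?S = k * 0] (mod int p)"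
    unfolding cong_def by (simp only: mult_zero_right)
  then show ?thesis
    by (rule cong_unit_cancel[OF \<open>unit k\<close>])
qed

end

section \<open>Functions satisfying the three-term Pluecker relations\<close>

text \<open>The four indices are taken in increasing order so that \<open>m\<close> can be a
  function of sets; for minors with sorted columns the relation then has this sign pattern for every
  \<open>A\<close>.\<close>

definition plucker :: "nat \<Rightarrow> nat set \<Rightarrow> (nat set \<Rightarrow> int) \<Rightarrow> bool" where
  "plucker k S m \<longleftrightarrow> (\<forall>A x y z w. A \<subseteq> S \<and> card A + 2 = k \<and> {x, y, z, w} \<subseteq> S - A \<and>
     x < y \<and> y < z \<and> z < w \<longrightarrow>
     m (A \<union> {x, y}) * m (A \<union> {z, w}) + m (A \<union> {x, w}) * m (A \<union> {y, z}) =
     m (A \<union> {x, z}) * m (A \<union> {y, w}))"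

lemma pluckerD:
  assumes "plucker k S m" "A \<subseteq> S" "card A + 2 = k" "{x, y, z, w} \<subseteq> S - A"
    and "x < y" "y < z" "z < w"
  shows "m (A \<union> {x, y}) * m (A \<union> {z, w}) + m (A \<union> {x, w}) * m (A \<union> {y, z}) =
     m (A \<union> {x, z}) * m (A \<union> {y, w})"
  using assms(1)[unfolded plucker_def, THEN spec, THEN spec, THEN spec, THEN spec, THEN spec] assms(2-)
  by simp

lemma plucker_subset:
  assumes "plucker k S m" "S' \<subseteq> S" shows "plucker k S' m"
  unfolding plucker_def
  by (intro allI impI, elim conjE, rule pluckerD[OF assms(1)]) (use assms(2) in auto)

text \<open>The complement of \<open>A \<union> {x, y}\<close> is \<open>B \<union> {z, w}\<close>,
  and likewise for the other pairs; complementation thus only swaps the two factors in each of the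
  three products.\<close>

lemma plucker_dual:
  assumes P: "plucker k S m" and S: "finite S"
  shows "plucker (card S - k) S (\<lambda>J. m (S - J))"
  unfolding plucker_def
proof (intro allI impI, elim conjE)
  fix A x y z w
  assume A: "A \<subseteq> S" "card A + 2 = card S - k" and xs: "{x, y, z, w} \<subseteq> S - A"
    and less: "x < y" "y < z" "z < w"
  define B where "B = S - (A \<union> {x, y, z, w})"
  have finA: "finite A" using A S finite_subset by blast
  have "card (A \<union> {x, y, z, w}) = card A + card {x, y, z, w}"
    using finA xs by (intro card_Un_disjoint) auto
  also have "\<dots> = card A + 4" using less by simp
  finally have "card B = card S - (card A + 4)"
    using A xs finA unfolding B_def by (subst card_Diff_subset) auto
  then have "card B + 2 = k"
    using A \<open>card (A \<union> {x, y, z, w}) = card A + card {x, y, z, w}\<close>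
      card_mono[OF S, of "A \<union> {x, y, z, w}"] xs less by auto
  moreover have "B \<subseteq> S" "{x, y, z, w} \<subseteq> S - B" using xs by (auto simp: B_def)
  ultimately have *: "m (B \<union> {x, y}) * m (B \<union> {z, w}) + m (B \<union> {x, w}) * m (B \<union> {y, z}) =
     m (B \<union> {x, z}) * m (B \<union> {y, w})"
    using less by (intro pluckerD[OF P])
  have eq: "S - (A \<union> {x, y}) = B \<union> {z, w}" "S - (A \<union> {z, w}) = B \<union> {x, y}"
    "S - (A \<union> {x, w}) = B \<union> {y, z}" "S - (A \<union> {y, z}) = B \<union> {x, w}"
    "S - (A \<union> {x, z}) = B \<union> {y, w}" "S - (A \<union> {y, w}) = B \<union> {x, z}"
    using xs less unfolding B_def by auto
  show "m (S - (A \<union> {x, y})) * m (S - (A \<union> {z, w})) + m (S - (A \<union> {x, w})) * m (S - (A \<union> {y, z})) =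
     m (S - (A \<union> {x, z})) * m (S - (A \<union> {y, w}))"
    unfolding eq using * by (simp add: mult.commute)
qed

text \<open>Insertion sort by adjacent transpositions.\<close>

lemma four_point_wlog:
  fixes Q :: "'a :: linorder \<Rightarrow> 'a \<Rightarrow> 'a \<Rightarrow> 'a \<Rightarrow> bool"
  assumes s1: "\<And>x y z w. Q x y z w \<Longrightarrow> Q y x z w"
    and s2: "\<And>x y z w. Q x y z w \<Longrightarrow> Q x z y w"
    and s3: "\<And>x y z w. Q x y z w \<Longrightarrow> Q x y w z"
    and sorted: "\<And>x y z w. x \<le> y \<Longrightarrow> y \<le> z \<Longrightarrow> z \<le> w \<Longrightarrow> Q x y z w"
  shows "Q x y z w"
proof -
  have 1: "Q x y z w" if "x \<le> y" "y \<le> z" for x y z w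
  proof -
    consider "z \<le> w" | "y \<le> w" "w \<le> z" | "x \<le> w" "w \<le> y" | "w \<le> x" by fastforce
    then show ?thesis
      by cases (use that in \<open>blast intro: sorted s1 s2 s3\<close>)+
  qed
  have 2: "Q x y z w" if "x \<le> y" for x y z w
  proof -
    consider "y \<le> z" | "x \<le> z" "z \<le> y" | "z \<le> x" by fastforce
    then show ?thesis
      by cases (use that in \<open>blast intro: 1 s1 s2\<close>)+
  qed
  show ?thesis using 2 s1 by (cases "x \<le> y") auto
qed

text \<open>The sign makes the value alternating in \<open>x\<close> and \<open>y\<close>. It can
  then play the role of \<open>area\<close>, with a relation valid for four points in any
  order.\<close>

definition oriented :: "(nat set \<Rightarrow> int) \<Rightarrow> nat set \<Rightarrow> nat \<Rightarrow> nat \<Rightarrow> int" where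
  "oriented m A x y = (if x < y then 1 else if y < x then - 1 else 0) * m (A \<union> {x, y})"

lemma oriented_swap: "oriented m A y x = - oriented m A x y"
  by (simp add: oriented_def insert_commute)

lemma oriented_self [simp]: "oriented m A x x = 0"
  by (simp add: oriented_def)

lemma oriented_plucker:
  assumes P: "plucker k S m" and A: "A \<subseteq> S" "card A + 2 = k"
    and "x \<in> S - A" "y \<in> S - A" "z \<in> S - A" "w \<in> S - A"
  defines "d \<equiv> oriented m A"
  shows "d x y * d z w + d x w * d y z = d x z * d y w"
proof -
  define Q where "Q x y z w \<longleftrightarrow> {x, y, z, w} \<subseteq> S - A \<longrightarrow>
    d x y * d z w + d x w * d y z = d x z * d y w" for x y z w
  have sw: "d y x = - d x y" for x y by (simp add: d_def oriented_swap[of m A y x])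
  have s0: "d x x = 0" for x by (simp add: d_def)
  have "Q x y z w"
  proof (rule four_point_wlog[of Q])
    show "Q y x z w" if "Q x y z w" for x y z w
      using that unfolding Q_def by (auto simp: sw[of y x] mult.commute)
    show "Q x z y w" if "Q x y z w" for x y z w
      using that unfolding Q_def by (auto simp: sw[of z y] mult.commute)
    show "Q x y w z" if "Q x y z w" for x y z w
      using that unfolding Q_def by (auto simp: sw[of w z] mult.commute)
    fix x y z w :: nat
    assume le: "x \<le> y" "y \<le> z" "z \<le> w"
    consider "x = y" | "y = z" | "z = w" | "x < y" "y < z" "z < w"
      using le by linarith
    then show "Q x y z w"
    proof cases
      case 4
      have "x < z" "y < w" "x < w" using 4 by auto
      show ?thesis
        using P A 4 unfolding Q_def plucker_def d_def oriented_def
        using \<open>x < z\<close> \<open>y < w\<close> \<open>x < w\<close> by simp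
    qed (auto simp: Q_def s0 sw[of _ y] sw[of z w])
  qed
  then show ?thesis using assms unfolding Q_def by simp
qed

section \<open>From Pluecker functions to relations between units\<close>

context prime_modulus
begin

definition uniform :: "nat \<Rightarrow> nat set \<Rightarrow> (nat set \<Rightarrow> int) \<Rightarrow> bool" where
  "uniform k S m \<longleftrightarrow> (\<forall>J\<subseteq>S. card J = k \<longrightarrow> unit (m J))"

lemma uniform_subset: "uniform k S m \<Longrightarrow> S' \<subseteq> S \<Longrightarrow> uniform k S' m"
  unfolding uniform_def by auto

lemma uniform_dual:
  assumes "uniform k S m" "finite S" "k \<le> card S"
  shows "uniform (card S - k) S (\<lambda>J. m (S - J))"
  unfolding uniform_def
proof (intro allI impI)
  fix J assume J: "J \<subseteq> S" "card J = card S - k"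
  then have "card (S - J) = k"
    using assms by (simp add: card_Diff_subset finite_subset)
  then show "unit (m (S - J))"
    using assms(1) unfolding uniform_def by auto
qed

lemma oriented_unit:
  assumes "uniform k S m" "finite S" "A \<subseteq> S" "card A + 2 = k"
    and "x \<in> S - A" "y \<in> S - A" "x \<noteq> y"
  shows "unit (oriented m A x y)"
proof -
  have finA: "finite A" using assms finite_subset by blast
  have "card (A \<union> {x, y}) = k" using assms finA by simp
  then have "unit (m (A \<union> {x, y}))" using assms unfolding uniform_def by simp
  then show ?thesis using assms by (auto simp: oriented_def)
qed

text \<open>For actual minors this is the image of column \<open>x\<close> in the quotient by the
  span of \<open>A\<close>, in coordinates given by \<open>u\<close> and \<open>v\<close>. In
  general \<open>area_place\<close> recovers \<open>oriented\<close> from it, up to one constant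
  factor.\<close>

definition place :: "(nat set \<Rightarrow> int) \<Rightarrow> nat set \<Rightarrow> nat \<Rightarrow> nat \<Rightarrow> nat \<Rightarrow> ivec" where
  "place m A u v x = IVec (oriented m A u x) (oriented m A v x)"

lemma area_place:
  assumes "plucker k S m" "A \<subseteq> S" "card A + 2 = k"
    and "u \<in> S - A" "v \<in> S - A" "x \<in> S - A" "y \<in> S - A"
  shows "area (place m A u v x) (place m A u v y) = oriented m A u v * oriented m A x y"
  using oriented_plucker[OF assms(1-3), of u v x y] assms(4-)
  by (simp add: place_def algebra_simps)

context
  fixes k S m A u v
  assumes P: "plucker k S m" and U: "uniform k S m" and S: "finite S"
    and A: "A \<subseteq> S" "card A + 2 = k"
    and uv: "u \<in> S - A" "v \<in> S - A" "u \<noteq> v"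
begin

lemma area_place_unit:
  assumes "x \<in> S - A" "y \<in> S - A" "x \<noteq> y"
  shows "unit (area (place m A u v x) (place m A u v y))"
  using oriented_unit[OF U S A assms] oriented_unit[OF U S A uv]
  by (simp add: area_place[OF P A uv(1,2) assms(1,2)])

lemma place_inj: "inj_on (place m A u v) (S - A)"
proof (rule inj_onI, rule ccontr)
  fix x y assume "x \<in> S - A" "y \<in> S - A" "place m A u v x = place m A u v y" "x \<noteq> y"
  then show False using area_place_unit[of x y] by (simp add: unit_def)
qed

lemma place_spread: "spread (place m A u v ` (S - A))"
  unfolding spread_def using area_place_unit S by blast

lemma place_prod:
  assumes "a \<in> E" "E \<subseteq> S - A"
  shows "(\<Prod>t\<in>place m A u v ` E - {place m A u v a}. area (place m A u v a) t)
    = oriented m A u v ^ (card E - 1) * (\<Prod>s\<in>E-{a}. oriented m A a s)"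
proof -
  have inj: "inj_on (place m A u v) E" by (rule inj_on_subset[OF place_inj assms(2)])
  have "place m A u v ` E - {place m A u v a} = place m A u v ` (E - {a})"
    using inj_on_image_set_diff[OF inj, of E "{a}"] assms by auto
  moreover have "inj_on (place m A u v) (E - {a})"
    by (rule inj_on_subset[OF inj]) auto
  ultimately have "(\<Prod>t\<in>place m A u v ` E - {place m A u v a}. area (place m A u v a) t)
      = (\<Prod>s\<in>E-{a}. area (place m A u v a) (place m A u v s))"
    by (simp add: prod.reindex)
  also have "\<dots> = (\<Prod>s\<in>E-{a}. oriented m A u v * oriented m A a s)"
    using assms by (intro prod.cong refl area_place[OF P A uv(1,2)]) auto
  also have "\<dots> = oriented m A u v ^ (card E - 1) * (\<Prod>s\<in>E-{a}. oriented m A a s)"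
    using assms(1) by (simp add: prod.distrib)
  finally show ?thesis .
qed

text \<open>This is \<open>spread_sum_zero\<close> for the placed columns. The constant
  \<open>oriented m A u v\<close> enters each summand with the same exponent, hence leaves the sum
  as a unit.\<close>

lemma oriented_sum_zero:
  assumes E: "E \<subseteq> S - A" "card E \<ge> 2" and c: "card (S - A) + card E = p + 3"
  shows "[(\<Sum>a\<in>E. rcp ((\<Prod>s\<in>S-A-{a}. oriented m A a s) * (\<Prod>e\<in>E-{a}. oriented m A a e))) = 0]
    (mod int p)"
proof -
  let ?f = "place m A u v" and ?d = "oriented m A"
  let ?F = "\<lambda>a. rcp ((\<Prod>t\<in>?f`(S-A)-{a}. area a t) * (\<Prod>t\<in>?f`E-{a}. area a t))"
  let ?G = "\<lambda>a. rcp ((\<Prod>s\<in>S-A-{a}. ?d a s) * (\<Prod>e\<in>E-{a}. ?d a e))"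
  let ?k = "rcp (?d u v ^ (card (S - A) - 1) * ?d u v ^ (card E - 1))"
  have inj: "inj_on ?f E" by (rule inj_on_subset[OF place_inj E(1)])
  have "[(\<Sum>t\<in>?f`E. ?F t) = 0] (mod int p)"
    using E c card_image[OF inj] card_image[OF place_inj]
    by (intro spread_sum_zero place_spread image_mono) auto
  moreover have "(\<Sum>t\<in>?f`E. ?F t) = (\<Sum>a\<in>E. ?F (?f a))"
    using inj by (simp add: sum.reindex)
  moreover have "\<dots> = (\<Sum>a\<in>E. ?k * ?G a)"
  proof (rule sum.cong[OF refl])
    fix a assume a: "a \<in> E"
    have "(\<Prod>t\<in>?f`(S-A)-{?f a}. area (?f a) t)
        = ?d u v ^ (card (S-A) - 1) * (\<Prod>s\<in>S-A-{a}. ?d a s)"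
      using a E by (intro place_prod) auto
    moreover have "(\<Prod>t\<in>?f`E-{?f a}. area (?f a) t)
        = ?d u v ^ (card E - 1) * (\<Prod>s\<in>E-{a}. ?d a s)"
      by (rule place_prod[OF a E(1)])
    ultimately show "?F (?f a) = ?k * ?G a"
      by (simp only: rcp_mult mult_ac)
  qed
  moreover have "\<dots> = ?k * (\<Sum>a\<in>E. ?G a)" by (simp add: sum_distrib_left)
  ultimately have "[?k * (\<Sum>a\<in>E. ?G a) = ?k * 0] (mod int p)" by simp
  moreover have "unit ?k"
    using oriented_unit[OF U S A uv] by (simp add: unit_power)
  ultimately show ?thesis using cong_unit_cancel by blast
qed

end

text \<open>With \<open>A\<close> empty, the elements of \<open>S\<close> themselves become distinct
  points of a projective line, which has only \<open>p + 1\<close> points.\<close>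

lemma card_uniform_rank_two:
  assumes P: "plucker 2 S m" and U: "uniform 2 S m" and S: "finite S"
  shows "card S \<le> p + 1"
proof (cases "card S \<ge> 2")
  case True
  then obtain u v where uv: "u \<in> S - {}" "v \<in> S - {}" "u \<noteq> v"
    using card_le_Suc0_iff_eq[OF S] by auto
  have "card (place m {} u v ` (S - {})) \<le> p + 1"
    by (intro card_spread_le place_spread[OF P U S] uv) auto
  moreover have "card (place m {} u v ` (S - {})) = card (S - {})"
    by (intro card_image place_inj[OF P U S] uv) auto
  ultimately show ?thesis by simp
qed simp

text \<open>The unknowns of the linear system. For every way of writing \<open>C\<close> as
  \<open>insert a A\<close> this is, up to sign, the summand of \<open>oriented_sum_zero\<close> at
  \<open>a\<close>; depending on \<open>C\<close> alone, it links the relations of different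
  \<open>A\<close>.\<close>

definition weight :: "nat set \<Rightarrow> nat set \<Rightarrow> (nat set \<Rightarrow> int) \<Rightarrow> nat set \<Rightarrow> int" where
  "weight S E m C = rcp ((\<Prod>s\<in>S-C. m (insert s C)) * (\<Prod>e\<in>E-C. m (insert e C)))"

lemma prod_oriented:
  assumes "finite T"
  shows "(\<Prod>s\<in>T-{a}. oriented m A a s) = (- 1) ^ card {s\<in>T. s < a} * (\<Prod>s\<in>T-{a}. m (A \<union> {a, s}))"
proof -
  have "(\<Prod>s\<in>T-{a}. oriented m A a s)
      = (\<Prod>s\<in>T-{a}. (if s < a then - 1 else 1) * m (A \<union> {a, s}))"
    by (intro prod.cong) (auto simp: oriented_def)
  also have "\<dots> = (\<Prod>s\<in>T-{a}. if s < a then - 1 else 1) * (\<Prod>s\<in>T-{a}. m (A \<union> {a, s}))"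
    by (simp add: prod.distrib)
  also have "(\<Prod>s\<in>T-{a}. if s < a then - 1 else 1 :: int) = (- 1) ^ card {s\<in>T. s < a}"
  proof -
    have "(T - {a}) \<inter> {s. s < a} = {s\<in>T. s < a}" by auto
    then show ?thesis using assms by (simp add: prod.If_cases)
  qed
  finally show ?thesis .
qed

text \<open>Since \<open>E\<close> is an initial segment of \<open>S\<close>, the signs of the two products in
  \<open>oriented_sum_zero\<close> agree and cancel; what remains depends only on the set \<open>insert a A\<close>.\<close>

lemma weight_sum_zero:
  assumes P: "plucker k S m" and U: "uniform k S m" and S: "finite S"
    and E: "E \<subseteq> S" "\<And>s e. s \<in> S \<Longrightarrow> e \<in> E \<Longrightarrow> s < e \<Longrightarrow> s \<in> E"
    and A: "A \<subseteq> E" "card A + 2 = k"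
    and c: "card (E - A) \<ge> 2" "card (S - A) + card (E - A) = p + 3"
  shows "[(\<Sum>a\<in>E-A. weight S E m (insert a A)) = 0] (mod int p)"
proof -
  have fin: "finite (S - A)" "finite (E - A)" using S E finite_subset by blast+
  obtain u v where uv: "u \<in> E - A" "v \<in> E - A" "u \<noteq> v"
    using card_le_Suc0_iff_eq[OF fin(2)] c(1) by auto
  have "(\<Sum>a\<in>E-A. weight S E m (insert a A))
      = (\<Sum>a\<in>E-A. rcp ((\<Prod>s\<in>S-A-{a}. oriented m A a s) * (\<Prod>e\<in>E-A-{a}. oriented m A a e)))"
  proof (rule sum.cong[OF refl])
    fix a assume a: "a \<in> E - A"
    have eq: "{s\<in>S-A. s < a} = {s\<in>E-A. s < a}" using a E by auto
    have "(\<Prod>s\<in>S-A-{a}. oriented m A a s) * (\<Prod>e\<in>E-A-{a}. oriented m A a e)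
        = (\<Prod>s\<in>S-A-{a}. m (A \<union> {a, s})) * (\<Prod>e\<in>E-A-{a}. m (A \<union> {a, e}))"
      unfolding prod_oriented[OF fin(1)] prod_oriented[OF fin(2)] eq
      by (simp add: mult_ac flip: power_add)
    moreover have "S - A - {a} = S - insert a A" "E - A - {a} = E - insert a A" by auto
    moreover have "A \<union> {a, s} = insert s (insert a A)" for s by auto
    ultimately show "weight S E m (insert a A)
        = rcp ((\<Prod>s\<in>S-A-{a}. oriented m A a s) * (\<Prod>e\<in>E-A-{a}. oriented m A a e))"
      by (simp add: weight_def)
  qed
  also have "[\<dots> = 0] (mod int p)"
    using A E uv c by (intro oriented_sum_zero[OF P U S _ A(2)]) auto
  finally show ?thesis .
qed

end

section \<open>Ball's theorem\<close>

context prime_modulus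
begin

text \<open>Deleting an element of \<open>D\<close> lowers the intersection by one, deleting any
  other element keeps it. The first term counts \<open>C \<inter> D\<close>, the second
  \<open>C - D\<close>.\<close>

lemma count_removals:
  assumes "finite C" "card C = q"
  shows "int (card {a\<in>C. card ((C - {a}) \<inter> D) = i})
    = (if card (C \<inter> D) = Suc i then int (Suc i) else 0) + (if card (C \<inter> D) = i then int q - int i else 0)"
proof -
  have del: "card ((C - {a}) \<inter> D) = (if a \<in> D then card (C \<inter> D) - 1 else card (C \<inter> D))" if "a \<in> C" for a
  proof (cases "a \<in> D")
    case True
    then have "(C - {a}) \<inter> D = C \<inter> D - {a}" by auto
    then show ?thesis using True that by simp
  next
    case False
    then have "(C - {a}) \<inter> D = C \<inter> D" by auto
    then show ?thesis using False by simp
  qed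
  have pos: "card (C \<inter> D) > 0" if "a \<in> C" "a \<in> D" for a
    using that assms by (auto simp: card_gt_0_iff)
  have split: "card C = card (C \<inter> D) + card (C - D)"
    using assms(1) card_Un_disjoint[of "C \<inter> D" "C - D"] by (simp add: Int_Diff_disjoint Int_Diff_Un)
  consider "card (C \<inter> D) = Suc i" | "card (C \<inter> D) = i" | "card (C \<inter> D) \<noteq> Suc i" "card (C \<inter> D) \<noteq> i"
    by blast
  then show ?thesis
  proof cases
    case 1
    then have "{a\<in>C. card ((C - {a}) \<inter> D) = i} = C \<inter> D"
      using del by (auto split: if_splits)
    then show ?thesis using 1 by simp
  next
    case 2
    then have "{a\<in>C. card ((C - {a}) \<inter> D) = i} = C - D"
      using del pos by (auto split: if_splits) fastforce
    then show ?thesis using 2 split assms by simp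
  next
    case 3
    then have "{a\<in>C. card ((C - {a}) \<inter> D) = i} = {}"
      using del pos by (auto split: if_splits)
    then show ?thesis using 3 by (simp only: card.empty) simp
  qed
qed

text \<open>Double counting: the pairs \<open>(A, a)\<close> correspond to the pairs
  \<open>(C, a)\<close> with \<open>C = insert a A\<close>, and \<open>count_removals\<close> gives
  the multiplicity of each \<open>C\<close>.\<close>

lemma sum_extensions:
  fixes f :: "nat set \<Rightarrow> int"
  assumes E: "finite E" and q: "q \<ge> 1"
  shows "(\<Sum>A | A \<subseteq> E \<and> card A = q - 1 \<and> card (A \<inter> D) = i. \<Sum>a\<in>E-A. f (insert a A))
    = int (Suc i) * (\<Sum>C | C \<subseteq> E \<and> card C = q \<and> card (C \<inter> D) = Suc i. f C)
      + (int q - int i) * (\<Sum>C | C \<subseteq> E \<and> card C = q \<and> card (C \<inter> D) = i. f C)"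
proof -
  let ?As = "{A. A \<subseteq> E \<and> card A = q - 1 \<and> card (A \<inter> D) = i}"
  let ?Cs = "{C. C \<subseteq> E \<and> card C = q}"
  have finA: "finite ?As" and finC: "finite ?Cs"
    using E by (auto intro: finite_subset[of _ "Pow E"])
  have finsub: "finite C" if "C \<subseteq> E" for C using that E finite_subset by blast
  have "(\<Sum>A\<in>?As. \<Sum>a\<in>E-A. f (insert a A)) = (\<Sum>(A, a)\<in>Sigma ?As (\<lambda>A. E - A). f (insert a A))"
    using finA E by (intro sum.Sigma) auto
  also have "\<dots> = (\<Sum>(C, a)\<in>Sigma ?Cs (\<lambda>C. {a\<in>C. card ((C - {a}) \<inter> D) = i}). f C)"
    using q finsub
    by (intro sum.reindex_bij_witness[of _ "\<lambda>(C, a). (C - {a}, a)" "\<lambda>(A, a). (insert a A, a)"])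
       (auto simp: card_insert_if insert_absorb)
  also have "\<dots> = (\<Sum>C\<in>?Cs. \<Sum>a | a \<in> C \<and> card ((C - {a}) \<inter> D) = i. f C)"
    using finC finsub by (subst sum.Sigma) auto
  also have "\<dots> = (\<Sum>C\<in>?Cs. int (card {a\<in>C. card ((C - {a}) \<inter> D) = i}) * f C)"
    by simp
  also have "\<dots> = (\<Sum>C\<in>?Cs. int (Suc i) * (if card (C \<inter> D) = Suc i then f C else 0)
      + (int q - int i) * (if card (C \<inter> D) = i then f C else 0))"
    using finsub by (intro sum.cong refl) (subst count_removals[where q = q], auto simp: algebra_simps)
  also have "\<dots> = int (Suc i) * (\<Sum>C\<in>?Cs. if card (C \<inter> D) = Suc i then f C else 0)
      + (int q - int i) * (\<Sum>C\<in>?Cs. if card (C \<inter> D) = i then f C else 0)"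
    by (simp add: sum.distrib sum_distrib_left)
  finally show ?thesis
    using finC by (simp add: sum.inter_filter[symmetric] conj_ac)
qed

text \<open>Let \<open>s i\<close> collect the \<open>q\<close>-sets that meet \<open>D\<close> in
  \<open>i\<close> elements. Adding the hypotheses over all \<open>A\<close> with
  \<open>card (A \<inter> D) = i\<close> gives
  \<open>(i + 1) * s (i + 1) + (q - i) * s i = 0\<close>, where \<open>i + 1 \<le> q < p\<close> is
  invertible. This climbs from \<open>s 0\<close>, an empty sum because two disjoint
  \<open>q\<close>-sets do not fit into \<open>E\<close>, to \<open>s q = f D\<close>.\<close>

lemma inclusion_kernel_trivial:
  fixes f :: "nat set \<Rightarrow> int"
  assumes E: "finite E" "card E < 2 * q" and q: "q \<ge> 1" "q < p"
    and zero: "\<And>A. A \<subseteq> E \<Longrightarrow> card A = q - 1 \<Longrightarrow> [(\<Sum>a\<in>E-A. f (insert a A)) = 0] (mod int p)"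
    and D: "D \<subseteq> E" "card D = q"
  shows "[f D = 0] (mod int p)"
proof -
  define s where "s i = (\<Sum>C | C \<subseteq> E \<and> card C = q \<and> card (C \<inter> D) = i. f C)" for i
  have finD: "finite D" using D E finite_subset by blast
  have s: "[s i = 0] (mod int p)" if "i \<le> q" for i
    using that
  proof (induction i)
    case 0
    have "{C. C \<subseteq> E \<and> card C = q \<and> card (C \<inter> D) = 0} = {}"
    proof (intro equals0I, clarify)
      fix C assume C: "C \<subseteq> E" "q = card C" "card (C \<inter> D) = 0"
      have "finite C" using C E finite_subset by blast
      then have "card (C \<union> D) = 2 * q"
        using C D finD card_Un_Int[of C D] by simp
      then show False using card_mono[OF E(1), of "C \<union> D"] C D E by simp
    qed
    then show ?case by (simp only: s_def sum.empty cong_refl)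
  next
    case (Suc i)
    have "[(\<Sum>A | A \<subseteq> E \<and> card A = q - 1 \<and> card (A \<inter> D) = i. \<Sum>a\<in>E-A. f (insert a A))
        = (\<Sum>A | A \<subseteq> E \<and> card A = q - 1 \<and> card (A \<inter> D) = i. 0)] (mod int p)"
      by (intro cong_sum zero) auto
    then have "[int (Suc i) * s (Suc i) + (int q - int i) * s i = 0] (mod int p)"
      unfolding s_def sum_extensions[OF E(1) q(1)] by simp
    moreover have "[int (Suc i) * s (Suc i) + (int q - int i) * s i
        = int (Suc i) * s (Suc i) + (int q - int i) * 0] (mod int p)"
      using Suc by (intro cong_add cong_mult cong_refl) simp
    ultimately have "[int (Suc i) * s (Suc i) = int (Suc i) * 0] (mod int p)"
      unfolding cong_def by simp
    moreover have "unit (int (Suc i))"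
      using Suc.prems q by (auto simp: unit_def simp del: of_nat_Suc dest!: dvd_imp_le)
    ultimately show ?case by (rule cong_unit_cancel[rotated])
  qed
  have "{C. C \<subseteq> E \<and> card C = q \<and> card (C \<inter> D) = q} = {D}"
  proof (intro equalityI subsetI)
    fix C assume "C \<in> {C. C \<subseteq> E \<and> card C = q \<and> card (C \<inter> D) = q}"
    then have C: "C \<subseteq> E" "card C = q" "card (C \<inter> D) = q" by auto
    have "finite C" using C E finite_subset by blast
    then have "C \<inter> D = C" "C \<inter> D = D"
      using C D finD by (simp_all add: card_subset_eq)
    then show "C \<in> {D}" by simp
  qed (use D in auto)
  then show ?thesis using s[of q] by (simp add: s_def)
qed

section \<open>Contradiction from too many columns\<close>

lemma no_uniform_plucker_small:
  assumes P: "plucker k {..<p+2} m" and U: "uniform k {..<p+2} m"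
    and k: "2 \<le> k" "k \<le> p" "2 * k \<le> p + 5"
  shows False
\<comment> \<open>For \<open>k = 2\<close> the set \<open>?E\<close> would have one element, too few
  nodes for \<open>weight_sum_zero\<close>.\<close>
proof (cases "k = 2")
  case True
  then show ?thesis using card_uniform_rank_two[of "{..<p+2}" m] P U by simp
next
  case False
  \<comment> \<open>An initial segment, as \<open>weight_sum_zero\<close> demands; it lies inside
    \<open>?S\<close> because \<open>2 * k \<le> p + 5\<close>.\<close>
  let ?S = "{..<p+2}" and ?E = "{..<2*k-3}"
  have k3: "k \<ge> 3" using False k by simp
  have ES: "?E \<subseteq> ?S" using k by auto
  let ?f = "weight ?S ?E m" and ?D = "{..<k-1}"
  have D: "?D \<subseteq> ?E" using k3 by auto
  have "[?f ?D = 0] (mod int p)"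
  proof (rule inclusion_kernel_trivial[of ?E "k - 1"])
    fix A assume A: "A \<subseteq> ?E" "card A = k - 1 - 1"
    have fin: "finite A" using A finite_subset by blast
    have "A \<subseteq> ?S" using A(1) ES by (rule order_trans)
    then have cards: "card (?E - A) = k - 1" "card (?S - A) = p + 4 - k"
      using A k k3 fin by (simp_all add: card_Diff_subset)
    show "[(\<Sum>a\<in>?E-A. ?f (insert a A)) = 0] (mod int p)"
      by (rule weight_sum_zero[OF P U]) (use A ES k k3 cards in auto)
  qed (use k k3 D in auto)
  \<comment> \<open>The system forces every weight to vanish, but weights are inverses of products
    of units.\<close>
  moreover have "unit (?f ?D)"
  proof -
    have "unit (m (insert s ?D))" if "s \<in> ?S - ?D" for s
    proof -
      have "card (insert s ?D) = k" using that k3 by simp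
      moreover have "insert s ?D \<subseteq> ?S" using that k by auto
      ultimately show ?thesis using U unfolding uniform_def by blast
    qed
    then show ?thesis
      unfolding weight_def using ES by (intro unit_rcp unit_mult[THEN iffD2] conjI unit_prod) auto
  qed
  ultimately show False by (simp add: unit_def cong_0_iff)
qed

lemma no_uniform_plucker:
  assumes P: "plucker k {..<p+2} m" and U: "uniform k {..<p+2} m" and k: "2 \<le> k" "k \<le> p"
  shows False
proof (cases "2 * k \<le> p + 5")
  case True
  then show ?thesis using no_uniform_plucker_small[OF P U k] by simp
next
  case False
  have "plucker (p + 2 - k) {..<p+2} (\<lambda>J. m ({..<p+2} - J))"
    using plucker_dual[OF P] by simp
  moreover have "uniform (p + 2 - k) {..<p+2} (\<lambda>J. m ({..<p+2} - J))"
    using uniform_dual[OF U] k by simp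
  ultimately show ?thesis
    by (rule no_uniform_plucker_small) (use False k in auto)
qed

theorem card_uniform_le:
  assumes P: "plucker k {..<n} m" and U: "uniform k {..<n} m" and k: "2 \<le> k"
  shows "n \<le> max k p + 1"
proof (rule ccontr)
  assume n: "\<not> n \<le> max k p + 1"
  show False
  proof (cases "k \<le> p")
    case True
    have sub: "{..<p+2} \<subseteq> {..<n}" using n True by auto
    show False
      by (rule no_uniform_plucker[OF plucker_subset[OF P sub] uniform_subset[OF U sub] k True])
  next
    case False
    have sub: "{..<k+2} \<subseteq> {..<n}" using n False by auto
    have "plucker 2 {..<k+2} (\<lambda>J. m ({..<k+2} - J))"
      using plucker_dual[OF plucker_subset[OF P sub]] by simp
    moreover have "uniform 2 {..<k+2} (\<lambda>J. m ({..<k+2} - J))"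
      using uniform_dual[OF uniform_subset[OF U sub]] by simp
    ultimately have "k + 2 \<le> p + 1"
      using card_uniform_rank_two[of "{..<k+2}"] by simp
    then show False using False by simp
  qed
qed

end

section \<open>Maximal minors\<close>

definition det_cols :: "nat \<Rightarrow> 'a :: comm_ring_1 vec list \<Rightarrow> 'a" where
  "det_cols r ws = det (mat_of_cols r ws)"

lemma det_cols_swap:
  assumes "length us + length vs + 2 = r"
  shows "det_cols r (us @ b # a # vs) = - det_cols r (us @ a # b # vs)"
proof -
  let ?A = "mat_of_cols r (us @ a # b # vs)" and ?k = "length us"
  have A: "?A \<in> carrier_mat r r" using assms by (intro carrier_matI) auto
  have "mat_of_cols r (us @ b # a # vs) = swapcols ?k (Suc ?k) ?A"
  proof (rule eq_matI)
    fix i j assume "i < dim_row (swapcols ?k (Suc ?k) ?A)" "j < dim_col (swapcols ?k (Suc ?k) ?A)"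
    then have ij: "i < r" "j < r" using A by auto
    consider "j < ?k" | "j = ?k" | "j = Suc ?k" | l where "j = Suc (Suc (?k + l))"
      using less_imp_Suc_add[of "Suc ?k" j] by (metis add_Suc less_antisym linorder_neqE_nat)
    then show "mat_of_cols r (us @ b # a # vs) $$ (i, j) = swapcols ?k (Suc ?k) ?A $$ (i, j)"
      using ij assms by cases (auto simp: mat_of_cols_index nth_append)
  qed (use assms in auto)
  then show ?thesis
    using det_swapcols[OF _ _ _ A, of ?k "Suc ?k"] assms by (simp add: det_cols_def)
qed

lemma det_cols_move:
  assumes "length ps + length us + length vs + 1 = r"
  shows "det_cols r (ps @ us @ a # vs) = (- 1) ^ length us * det_cols r (ps @ a # us @ vs)"
  using assms
proof (induction us arbitrary: vs rule: rev_induct)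
  case (snoc u us)
  have "det_cols r ((ps @ us) @ u # a # vs) = - det_cols r ((ps @ us) @ a # u # vs)"
    using snoc.prems by (intro det_cols_swap) auto
  also have "det_cols r ((ps @ us) @ a # u # vs) = (- 1) ^ length us * det_cols r (ps @ a # us @ u # vs)"
    using snoc.IH[of "u # vs"] snoc.prems by simp
  finally show ?case by simp
qed simp

lemma det_cols_identical:
  fixes ws :: "'a :: comm_ring_1 vec list"
  assumes "length ws = r" "i < r" "j < r" "i \<noteq> j" "ws ! i = ws ! j" 
  shows "det_cols r ws = 0"
  unfolding det_cols_def
proof (rule det_identical_columns[of _ r i j])
  show "mat_of_cols r ws \<in> carrier_mat r r" using assms by (intro carrier_matI) auto
  show "col (mat_of_cols r ws) i = col (mat_of_cols r ws) j"
    using assms by (intro eq_vecI) (auto simp: mat_of_cols_index)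
qed (use assms in auto)

text \<open>Laplace expansion along the column of \<open>v\<close>: the cofactors do not involve
  \<open>v\<close>, so those obtained with the zero vector in its place serve for all
  \<open>v\<close>.\<close>

lemma det_cols_linear:
  fixes us vs :: "'a :: comm_ring_1 vec list"
  assumes "length us + length vs + 1 = r"
  obtains c where "\<And>v. det_cols r (us @ v # vs) = (\<Sum>i<r. v $ i * c i)"
proof
  fix v
  let ?M = "\<lambda>v. mat_of_cols r (us @ v # vs)"
  have M: "?M v \<in> carrier_mat r r" using assms by (intro carrier_matI) auto
  have "det (?M v) = (\<Sum>i<r. ?M v $$ (i, length us) * cofactor (?M v) i (length us))"
    using assms by (intro laplace_expansion_column[OF M]) auto
  also have "\<dots> = (\<Sum>i<r. v $ i * cofactor (?M (0\<^sub>v r)) i (length us))"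
  proof (rule sum.cong[OF refl])
    fix i assume i: "i \<in> {..<r}"
    have "mat_delete (?M v) i (length us) = mat_delete (?M (0\<^sub>v r)) i (length us)"
    proof (rule eq_matI)
      fix i' j' assume "i' < dim_row (mat_delete (?M (0\<^sub>v r)) i (length us))"
        "j' < dim_col (mat_delete (?M (0\<^sub>v r)) i (length us))"
      then show "mat_delete (?M v) i (length us) $$ (i', j')
          = mat_delete (?M (0\<^sub>v r)) i (length us) $$ (i', j')"
        using assms by (auto simp: mat_delete_def mat_of_cols_index nth_append nth_Cons')
    qed auto
    then show "?M v $$ (i, length us) * cofactor (?M v) i (length us)
        = v $ i * cofactor (?M (0\<^sub>v r)) i (length us)"
      using i assms by (simp add: cofactor_def mat_of_cols_index)
  qed
  finally show "det_cols r (us @ v # vs) = (\<Sum>i<r. v $ i * cofactor (?M (0\<^sub>v r)) i (length us))"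
    by (simp add: det_cols_def)
qed

text \<open>Seen as a function of \<open>w\<close>, the difference of the two sides is a linear form that vanishes on
  the basis \<open>x, y, bs\<close>.\<close>

lemma det_cols_plucker:
  fixes bs :: "'a :: idom vec list"
  assumes len: "length bs + 2 = r" and nz: "det_cols r (x # y # bs) \<noteq> 0"
  defines "F \<equiv> \<lambda>u v. det_cols r (u # v # bs)"
  shows "F x y * F z w + F x w * F y z = F x z * F y w"
proof -
  have swap: "F v u = - F u v" for u v
    using det_cols_swap[of "[]" bs r v u] len by (simp add: F_def)
  have same: "F u u = 0" for u
    unfolding F_def using len by (intro det_cols_identical[of _ _ 0 1]) auto
  have mem: "F u b = 0" if b: "b \<in> set bs" for u b
  proof -
    obtain l where "l < length bs" "bs ! l = b" using b by (auto simp: in_set_conv_nth)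
    then show ?thesis
      unfolding F_def using len by (intro det_cols_identical[of _ _ 1 "Suc (Suc l)"]) auto
  qed
  have "\<exists>c. \<forall>v. F u v = (\<Sum>i<r. v $ i * c i)" for u
    using det_cols_linear[of "[u]" bs r] len by (fastforce simp: F_def)
  then obtain c where c: "\<And>u v. F u v = (\<Sum>i<r. v $ i * c u i)" by metis
  define e where "e i = F x y * c z i + c x i * F y z - F x z * c y i" for i
  have phi: "(\<Sum>i<r. v $ i * e i) = F x y * F z v + F x v * F y z - F x z * F y v" for v
    unfolding c[of z v] c[of x v] c[of y v] e_def
    by (simp add: sum_distrib_left sum_distrib_right sum.distrib sum_subtractf algebra_simps)
  let ?M = "mat_of_cols r (x # y # bs)"
  have M: "?M \<in> carrier_mat r r" using len by (intro carrier_matI) auto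
  have "?M\<^sup>T *\<^sub>v vec r e = 0\<^sub>v r"
  proof (rule eq_vecI)
    fix j assume "j < dim_vec (0\<^sub>v r :: 'a vec)"
    then have j: "j < r" by simp
    let ?v = "(x # y # bs) ! j"
    have "(?M\<^sup>T *\<^sub>v vec r e) $ j = (\<Sum>i<r. ?v $ i * e i)"
      using j len by (auto simp: scalar_prod_def mat_of_cols_index atLeast0LessThan intro!: sum.cong)
    also have "\<dots> = 0"
    proof -
      have "?v \<in> set (x # y # bs)" using j len by (intro nth_mem) simp
      then consider "?v = x" | "?v = y" | "?v \<in> set bs" by auto
      then show ?thesis
        unfolding phi by cases (auto simp: same mem swap[of z x] swap[of z y] swap[of y x] mult.commute)
    qed
    finally show "(?M\<^sup>T *\<^sub>v vec r e) $ j = 0\<^sub>v r $ j" using j by simp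
  qed (use len in auto)
  moreover have "det (?M\<^sup>T) \<noteq> 0"
    using nz M by (simp add: det_transpose det_cols_def)
  moreover have "?M\<^sup>T \<in> carrier_mat r r" using M by simp
  ultimately have "vec r e = 0\<^sub>v r"
    using det_0_iff_vec_prod_zero[of "?M\<^sup>T" r] vec_carrier[of r e] by blast
  then have "e i = 0" if "i < r" for i
    using that by (metis index_vec index_zero_vec(1))
  then have "(\<Sum>i<r. w $ i * e i) = 0" by simp
  then show ?thesis unfolding phi by simp
qed

section \<open>Minors as functions of the set of columns\<close>

lemma sorted_list_of_set_insert_split:
  assumes "finite B" "x \<notin> B"
  obtains us vs where "sorted_list_of_set B = us @ vs"
    and "sorted_list_of_set (insert x B) = us @ x # vs" and "length us = card {b\<in>B. b < x}"
proof
  let ?us = "sorted_list_of_set {b\<in>B. b < x}" and ?vs = "sorted_list_of_set {b\<in>B. x < b}"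
  have cmp: "b < x \<or> x < b" if "b \<in> B" for b using assms that by (cases b x rule: linorder_cases) auto
  have fin: "finite {b\<in>B. b < x}" "finite {b\<in>B. x < b}" using assms by auto
  have sets: "set ?us = {b\<in>B. b < x}" "set ?vs = {b\<in>B. x < b}"
    "set (sorted_list_of_set B) = B" "set (sorted_list_of_set (insert x B)) = insert x B"
    using fin assms(1) by (auto simp only: set_sorted_list_of_set finite_insert)
  show "sorted_list_of_set B = ?us @ ?vs"
  proof (rule sorted_distinct_set_unique)
    show "sorted (?us @ ?vs)" unfolding sorted_append sets by auto
    show "distinct (?us @ ?vs)" unfolding distinct_append sets by auto
    show "set (sorted_list_of_set B) = set (?us @ ?vs)" unfolding set_append sets using cmp by auto
  qed auto
  show "sorted_list_of_set (insert x B) = ?us @ x # ?vs"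
  proof (rule sorted_distinct_set_unique)
    show "sorted (?us @ x # ?vs)" unfolding sorted_append sorted_simps list.set sets by auto
    show "distinct (?us @ x # ?vs)" unfolding distinct_append distinct.simps list.set sets by auto
    show "set (sorted_list_of_set (insert x B)) = set (?us @ x # ?vs)"
      unfolding set_append list.set sets using cmp by auto
  qed auto
  show "length ?us = card {b\<in>B. b < x}" by simp
qed

definition sorted_minor :: "nat \<Rightarrow> (nat \<Rightarrow> 'a :: comm_ring_1 vec) \<Rightarrow> nat set \<Rightarrow> 'a" where
  "sorted_minor r c J = det_cols r (map c (sorted_list_of_set J))"

text \<open>The smaller index \<open>x\<close> moves to the front without passing \<open>y\<close>,
  so the sign splits into one factor for each index. This form is what makes the signs cancel in the
  Pluecker relation.\<close>

lemma sorted_minor_insert2: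
  assumes B: "finite B" "card B + 2 = r" and xy: "x \<notin> B" "y \<notin> B" "x < y"
  shows "sorted_minor r c (B \<union> {x, y}) = (- 1) ^ card {b\<in>B. b < x} * (- 1) ^ card {b\<in>B. b < y}
    * det_cols r (c x # c y # map c (sorted_list_of_set B))"
proof -
  have "finite (insert y B)" "x \<notin> insert y B" using B xy by auto
  then obtain us vs where 1: "sorted_list_of_set (insert y B) = us @ vs"
    "sorted_list_of_set (insert x (insert y B)) = us @ x # vs" "length us = card {b\<in>insert y B. b < x}"
    by (rule sorted_list_of_set_insert_split)
  obtain us' vs' where 2: "sorted_list_of_set B = us' @ vs'"
    "sorted_list_of_set (insert y B) = us' @ y # vs'" "length us' = card {b\<in>B. b < y}"
    using B(1) xy(2) by (rule sorted_list_of_set_insert_split)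
  have len: "length us + length vs + 1 = r" "length us' + length vs' + 2 = r"
    using arg_cong[OF 1(1), of length] arg_cong[OF 2(1), of length] B xy by auto
  have "{b\<in>insert y B. b < x} = {b\<in>B. b < x}" using xy by auto
  moreover have "B \<union> {x, y} = insert x (insert y B)" by auto
  ultimately have "sorted_minor r c (B \<union> {x, y})
      = (- 1) ^ card {b\<in>B. b < x} * det_cols r (c x # map c (us @ vs))"
    unfolding sorted_minor_def
    using det_cols_move[of "[]" "map c us" "map c vs" r "c x"] 1 len by simp
  also have "det_cols r (c x # map c (us @ vs))
      = (- 1) ^ card {b\<in>B. b < y} * det_cols r (c x # c y # map c (us' @ vs'))"
    using det_cols_move[of "[c x]" "map c us'" "map c vs'" r "c y"] 2 len 1(1) by simp
  finally show ?thesis using 2 by simp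
qed

text \<open>All three products carry the same sign, the product of the signs of \<open>x\<close>,
  \<open>y\<close>, \<open>z\<close> and \<open>w\<close>. The nonzero minors supply the basis on
  which \<open>det_cols_plucker\<close> rests.\<close>

lemma plucker_sorted_minor:
  fixes c :: "nat \<Rightarrow> int vec"
  assumes S: "finite S" and nz: "\<And>J. J \<subseteq> S \<Longrightarrow> card J = r \<Longrightarrow> sorted_minor r c J \<noteq> 0"
  shows "plucker r S (sorted_minor r c)"
  unfolding plucker_def
proof (intro allI impI, elim conjE)
  fix A x y z w
  assume A: "A \<subseteq> S" "card A + 2 = r" and xs: "{x, y, z, w} \<subseteq> S - A"
    and less: "x < y" "y < z" "z < w"
  have finA: "finite A" using A S finite_subset by blast
  let ?bs = "map c (sorted_list_of_set A)" and ?s = "\<lambda>x. (- 1) ^ card {b\<in>A. b < x} :: int"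
  let ?F = "\<lambda>u v. det_cols r (c u # c v # ?bs)"
  have eq: "sorted_minor r c (A \<union> {u, v}) = ?s u * ?s v * ?F u v"
    if "u \<in> S - A" "v \<in> S - A" "u < v" for u v
    using that by (intro sorted_minor_insert2[OF finA A(2)]) auto
  have "sorted_minor r c (A \<union> {x, y}) \<noteq> 0"
    using A xs less finA by (intro nz) auto
  then have "?F x y \<noteq> 0" using eq[of x y] xs less by auto
  then have "?F x y * ?F z w + ?F x w * ?F y z = ?F x z * ?F y w"
    using det_cols_plucker[of ?bs r "c x" "c y" "c z" "c w"] A finA by simp
  then have "(?s x * ?s y * ?s z * ?s w) * (?F x y * ?F z w + ?F x w * ?F y z)
      = (?s x * ?s y * ?s z * ?s w) * (?F x z * ?F y w)"
    by (simp only:)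
  moreover have "x < w" "x < z" "y < w" using less by auto
  ultimately show "sorted_minor r c (A \<union> {x, y}) * sorted_minor r c (A \<union> {z, w})
      + sorted_minor r c (A \<union> {x, w}) * sorted_minor r c (A \<union> {y, z})
      = sorted_minor r c (A \<union> {x, z}) * sorted_minor r c (A \<union> {y, w})"
    using xs less by (simp only: eq insert_subset) (simp add: algebra_simps)
qed

text \<open>\<open>submatrix\<close> numbers its columns by \<open>pick\<close>; this matches that
  numbering with the sorted list behind \<open>sorted_minor\<close>.\<close>

lemma pick_sorted_list_of_set:
  assumes J: "finite J" and j: "j < card J"
  shows "pick J j = sorted_list_of_set J ! j"
proof -
  let ?l = "sorted_list_of_set J"
  have mem: "?l ! j \<in> J" using j J nth_mem[of j ?l] by simp
  have less: "?l ! a < ?l ! b \<longleftrightarrow> a < b" if "a < card J" "b < card J" for a b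
    using that strict_sorted_list_of_set[of J] J
    by (metis length_sorted_list_of_set linorder_neqE_nat order_less_asym sorted_wrt_nth_less)
  have "{a\<in>J. a < ?l ! j} = (!) ?l ` {..<j}"
  proof (intro equalityI subsetI)
    fix a assume a: "a \<in> {a\<in>J. a < ?l ! j}"
    then have "a \<in> set ?l" using J by simp
    then obtain i where "i < card J" "a = ?l ! i" by (auto simp: in_set_conv_nth)
    then show "a \<in> (!) ?l ` {..<j}" using a less[of i j] j by auto
  next
    fix a assume "a \<in> (!) ?l ` {..<j}"
    then show "a \<in> {a\<in>J. a < ?l ! j}"
      using j less J nth_mem[of _ ?l] by force
  qed
  moreover have "inj_on ((!) ?l) {..<j}"
    using j J by (intro inj_on_nth) auto
  ultimately have "card {a\<in>J. a < ?l ! j} = j" by (simp add: card_image)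
  then show ?thesis using pick_card_in_set[OF mem] by simp
qed

lemma det_submatrix_sorted_minor:
  assumes A: "A \<in> carrier_mat r n" and J: "J \<subseteq> {..<n}" "card J = r"
  shows "det (submatrix A {..<r} J) = sorted_minor r (col A) J"
proof -
  have finJ: "finite J" using J finite_subset by blast
  have Jn: "{j. j < n \<and> j \<in> J} = J" using J by auto
  have rows: "{i. i < r \<and> i \<in> {..<r}} = {..<r}" by auto
  have "submatrix A {..<r} J = mat_of_cols r (map (col A) (sorted_list_of_set J))"
  proof (rule eq_matI)
    fix i j assume "i < dim_row (mat_of_cols r (map (col A) (sorted_list_of_set J)))"
      "j < dim_col (mat_of_cols r (map (col A) (sorted_list_of_set J)))"
    then have ij: "i < r" "j < r" using J finJ by auto
    have mem: "sorted_list_of_set J ! j \<in> J" using ij J finJ nth_mem[of j "sorted_list_of_set J"] by simp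
    have "submatrix A {..<r} J $$ (i, j) = A $$ (pick {..<r} i, pick J j)"
      using A ij J Jn rows by (intro submatrix_index) auto
    also have "pick {..<r} i = i"
    proof -
      have "{a\<in>{..<r}. a < i} = {..<i}" using ij by auto
      then show ?thesis using ij pick_card_in_set[of i "{..<r}"] by simp
    qed
    also have "pick J j = sorted_list_of_set J ! j"
      using ij J finJ by (intro pick_sorted_list_of_set) auto
    finally show "submatrix A {..<r} J $$ (i, j)
        = mat_of_cols r (map (col A) (sorted_list_of_set J)) $$ (i, j)"
      using ij J finJ A mem by (auto simp: mat_of_cols_index)
  qed (use A J Jn rows finJ in \<open>auto simp: dim_submatrix\<close>)
  then show ?thesis by (simp add: sorted_minor_def det_cols_def)
qed

lemma minors_full_rank:
  assumes A: "A \<in> carrier_mat r n"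
  shows "minors r A = {sorted_minor r (col A) J | J. J \<subseteq> {..<n} \<and> card J = r}"
proof -
  have "I = {..<r}" if "I \<subseteq> {..<r}" "card I = r" for I
    using that by (intro card_subset_eq) auto
  then show ?thesis
    unfolding minors_def using A det_submatrix_sorted_minor[OF A]
    by (intro Collect_cong) (metis carrier_matD card_lessThan order_refl)
qed

lemma generic_modular_card_le:
  assumes p: "prime p" "\<Delta> < p" and r: "r \<ge> 2" and n: "n \<in> generic_modular_col_numbers \<Delta> r"
  shows "n \<le> max r p + 1"
proof -
  interpret prime_modulus p by unfold_locales (rule p)
  obtain A where A: "A \<in> carrier_mat r n" "generic A" "modular \<Delta> A" "int_rank A = r"
    using n unfolding generic_modular_col_numbers_def by auto
  have bound: "sorted_minor r (col A) J \<noteq> 0 \<and> \<bar>sorted_minor r (col A) J\<bar> \<le> int \<Delta>"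
    if "J \<subseteq> {..<n}" "card J = r" for J
    using that A unfolding generic_def modular_def minors_full_rank[OF A(1)] A(4) by auto
  have "plucker r {..<n} (sorted_minor r (col A))"
    using bound by (intro plucker_sorted_minor) auto
  moreover have "uniform r {..<n} (sorted_minor r (col A))"
    unfolding uniform_def unit_def
  proof (intro allI impI notI)
    fix J assume "J \<subseteq> {..<n}" "card J = r" "int p dvd sorted_minor r (col A) J"
    then show False
      using bound[of J] p dvd_imp_le_int[of "sorted_minor r (col A) J" "int p"] by auto
  qed
  ultimately show ?thesis using r by (rule card_uniform_le)
qed

section \<open>A matrix with one column more than its rank\<close>

lemma rank_le_dim:
  assumes "(A :: 'a :: field mat) \<in> carrier_mat n nc"
  shows "vec_space.rank n A \<le> n"
proof -
  interpret vec_space "TYPE('a)" n .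
  have cols: "set (cols A) \<subseteq> carrier_vec n" using assms cols_dim by blast
  have "lin_indpt {}" using lin_dep_def by auto
  then obtain S where S: "maximal S (\<lambda>T. T \<subseteq> set (cols A) \<and> lin_indpt T)"
    using maximal_exists_superset[of "set (cols A)" "\<lambda>T. T \<subseteq> set (cols A) \<and> lin_indpt T" "{}"] by auto
  then have "S \<subseteq> carrier_vec n" "lin_indpt S" using cols unfolding maximal_def by auto
  then have "card S \<le> n" using li_le_dim(2)[of S] by (simp add: dim_is_n)
  then show ?thesis using rank_card_indpt[OF assms S] by simp
qed

text \<open>The minor stays nonzero over the rationals and bounds the rank from below; the number of
  rows bounds it from above.\<close>

lemma int_rank_full:
  assumes A: "A \<in> carrier_mat r n" and J: "J \<subseteq> {..<n}" "card J = r"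
    and nz: "sorted_minor r (col A) J \<noteq> 0"
  shows "int_rank A = r"
proof -
  let ?B = "map_mat rat_of_int A"
  have B: "?B \<in> carrier_mat r n" using A by simp
  have Jn: "{j. j < n \<and> j \<in> J} = J" using J by auto
  have Ir: "{i. i < r \<and> i \<in> {..<r}} = {..<r}" by auto
  have "submatrix ?B {..<r} J = map_mat rat_of_int (submatrix A {..<r} J)"
  proof (rule eq_matI)
    fix i j assume "i < dim_row (map_mat rat_of_int (submatrix A {..<r} J))"
      "j < dim_col (map_mat rat_of_int (submatrix A {..<r} J))"
    then have ij: "i < r" "j < r" using A J Jn Ir by (auto simp: dim_submatrix)
    have "pick {..<r} i < r" "pick J j < n"
      using ij J Jn Ir by (auto intro!: pick_le)
    then show "submatrix ?B {..<r} J $$ (i, j) = map_mat rat_of_int (submatrix A {..<r} J) $$ (i, j)"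
      using ij A J Jn Ir by (simp add: submatrix_def)
  qed (use A in \<open>auto simp: dim_submatrix\<close>)
  then have "det (submatrix ?B {..<r} J) \<noteq> 0"
    using nz det_submatrix_sorted_minor[OF A J] by (simp add: of_int_hom.hom_det)
  then have "card J \<le> vec_space.rank r ?B"
    using vec_space.rank_gt_minor[OF B, of "{..<r}" J] Jn by simp
  moreover have "vec_space.rank r ?B \<le> r" by (rule rank_le_dim[OF B])
  ultimately show ?thesis using A J by (simp add: int_rank_def)
qed

lemma det_unit_vecs: "det_cols r (map (unit_vec r) [0..<r]) = (1 :: 'a :: comm_ring_1)"
proof -
  have "mat_of_cols r (map (unit_vec r) [0..<r]) = (1\<^sub>m r :: 'a mat)"
    by (rule eq_matI) (auto simp: mat_of_cols_index)
  then show ?thesis by (simp add: det_cols_def)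
qed

text \<open>Cramer's rule for the identity matrix.\<close>

lemma det_unit_vecs_replace:
  assumes "i < r" and v: "(v :: 'a :: comm_ring_1 vec) \<in> carrier_vec r"
  shows "det_cols r (map (unit_vec r) [0..<i] @ v # map (unit_vec r) [Suc i..<r]) = v $ i"
proof -
  have "mat_of_cols r (map (unit_vec r) [0..<i] @ v # map (unit_vec r) [Suc i..<r])
      = replace_col (1\<^sub>m r) (1\<^sub>m r *\<^sub>v v) i"
  proof (rule eq_matI)
    fix a b assume "a < dim_row (replace_col (1\<^sub>m r) (1\<^sub>m r *\<^sub>v v) i)"
      "b < dim_col (replace_col (1\<^sub>m r) (1\<^sub>m r *\<^sub>v v) i)"
    then have ab: "a < r" "b < r" by (auto simp: replace_col_def)
    consider "b < i" | "b = i" | l where "b = Suc (i + l)"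
      by (metis less_imp_Suc_add linorder_neqE_nat)
    then show "mat_of_cols r (map (unit_vec r) [0..<i] @ v # map (unit_vec r) [Suc i..<r]) $$ (a, b)
        = replace_col (1\<^sub>m r) (1\<^sub>m r *\<^sub>v v) i $$ (a, b)"
      using ab v assms(1) by cases (auto simp: mat_of_cols_index replace_col_def nth_append)
  qed (use assms in \<open>auto simp: replace_col_def\<close>)
  then show ?thesis
    using cramer_lemma_mat[of "1\<^sub>m r" r v i] assms by (simp add: det_cols_def)
qed

text \<open>Each maximal minor omits one column: without the last it is the identity determinant,
  without the unit vector \<open>i\<close> it is the entry \<open>v $ i\<close> up to sign. So only
  1 and \<Delta> occur as absolute values.\<close>

lemma generic_modular_exists:
  assumes r: "r \<ge> 2" and \<Delta>: "\<Delta> \<ge> 1"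
  shows "r + 1 \<in> generic_modular_col_numbers \<Delta> r"
proof -
  define v where "v = vec r (\<lambda>i. if i = r - 1 then int \<Delta> else 1)"
  define c where "c j = (if j < r then unit_vec r j else v)" for j
  define A where "A = mat_of_cols r (map c [0..<r+1])"
  have v: "v \<in> carrier_vec r" by (simp add: v_def)
  have c_carrier: "c j \<in> carrier_vec r" for j using v by (simp add: c_def)
  have A: "A \<in> carrier_mat r (r + 1)" by (intro carrier_matI) (auto simp: A_def)
  have colA: "col A j = c j" if "j < r + 1" for j
  proof -
    have "map c [0..<r+1] ! j = c j" using that nth_map_upt[of j "r + 1" 0 c] by simp
    then show ?thesis using col_mat_of_cols[of j "map c [0..<r+1]" r] c_carrier that
      by (simp add: A_def del: upt_Suc)
  qed
  have sm: "sorted_minor r (col A) J = det_cols r (map c (sorted_list_of_set J))" if "J \<subseteq> {..<r+1}" for J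
  proof -
    have "finite J" using that finite_subset by blast
    then have "map (col A) (sorted_list_of_set J) = map c (sorted_list_of_set J)"
      using that colA by (intro map_cong) auto
    then show ?thesis by (simp only: sorted_minor_def)
  qed
  have last: "sorted_minor r (col A) {..<r} = 1"
  proof -
    have maps: "map c [0..<r] = map (unit_vec r) [0..<r]" by (simp add: c_def)
    have "sorted_minor r (col A) {..<r} = det_cols r (map c [0..<r])"
      by (subst sm) (auto simp: lessThan_atLeast0)
    then show ?thesis unfolding maps det_unit_vecs .
  qed
  have other: "\<bar>sorted_minor r (col A) ({..<r+1} - {i})\<bar> = \<bar>v $ i\<bar>" if i: "i < r" for i
  proof -
    have list: "sorted_list_of_set ({..<r+1} - {i}) = [0..<i] @ [Suc i..<r] @ [r]"
    proof (rule sorted_distinct_set_unique)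
      show "sorted ([0..<i] @ [Suc i..<r] @ [r])" using i by (auto simp: sorted_append)
      show "set (sorted_list_of_set ({..<r+1} - {i})) = set ([0..<i] @ [Suc i..<r] @ [r])"
        using i by (subst set_sorted_list_of_set) auto
    qed (use i in auto)
    have maps: "map c [0..<i] = map (unit_vec r) [0..<i]"
      "map c [Suc i..<r] = map (unit_vec r) [Suc i..<r]" "c r = v"
      using i by (auto simp: c_def)
    have "sorted_minor r (col A) ({..<r+1} - {i})
        = det_cols r (map (unit_vec r) [0..<i] @ map (unit_vec r) [Suc i..<r] @ [v])"
      unfolding sm[OF Diff_subset] list map_append list.map maps ..
    \<comment> \<open>From the last place \<open>v\<close> moves back into the gap at
      \<open>i\<close>, past \<open>r - Suc i\<close> unit vectors.\<close>
    also have "\<dots> = (- 1) ^ (r - Suc i) * v $ i"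
      using det_cols_move[of "map (unit_vec r) [0..<i]" "map (unit_vec r) [Suc i..<r]" "[]" r v]
        det_unit_vecs_replace[OF i v] i by simp
    finally show ?thesis by (simp add: abs_mult power_abs)
  qed
  have cases: "\<bar>sorted_minor r (col A) J\<bar> \<in> {1, int \<Delta>}" if J: "J \<subseteq> {..<r+1}" "card J = r" for J
  proof -
    have "finite J" using J(1) finite_subset by blast
    then have "card ({..<r+1} - J) = 1" using J by (simp add: card_Diff_subset)
    then obtain i where "{..<r+1} - J = {i}" by (auto simp: card_1_singleton_iff)
    then have i: "J = {..<r+1} - {i}" "i < r + 1" using J by auto
    show ?thesis
    proof (cases "i = r")
      case True
      then have "J = {..<r}" using i by auto
      then show ?thesis using last by simp
    next
      case False
      then show ?thesis using i other[of i] by (auto simp: v_def)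
    qed
  qed
  have bound: "sorted_minor r (col A) J \<noteq> 0" "\<bar>sorted_minor r (col A) J\<bar> \<le> int \<Delta>"
    if J: "J \<subseteq> {..<r+1}" "card J = r" for J
    using cases[OF J] \<Delta> by auto
  have rank: "int_rank A = r"
    by (rule int_rank_full[OF A, of "{..<r}"]) (use last in auto)
  have "generic A"
    unfolding generic_def rank minors_full_rank[OF A]
  proof
    fix m assume "m \<in> {sorted_minor r (col A) J |J. J \<subseteq> {..<r + 1} \<and> card J = r}"
    then obtain J where "m = sorted_minor r (col A) J" "J \<subseteq> {..<r + 1}" "card J = r" by blast
    then show "m \<noteq> 0" using bound(1)[of J] by simp
  qed
  moreover have "modular \<Delta> A"
    unfolding modular_def rank minors_full_rank[OF A]
  proof
    show "\<forall>m\<in>{sorted_minor r (col A) J |J. J \<subseteq> {..<r + 1} \<and> card J = r}. \<bar>m\<bar> \<le> int \<Delta>"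
    proof
      fix m assume "m \<in> {sorted_minor r (col A) J |J. J \<subseteq> {..<r + 1} \<and> card J = r}"
      then obtain J where "m = sorted_minor r (col A) J" "J \<subseteq> {..<r + 1}" "card J = r" by blast
      then show "\<bar>m\<bar> \<le> int \<Delta>" using bound(2)[of J] by simp
    qed
    let ?J = "{..<r+1} - {r - 1}"
    have "\<bar>sorted_minor r (col A) ?J\<bar> = int \<Delta>"
      using other[of "r - 1"] r by (simp add: v_def)
    then have "sorted_minor r (col A) ?J = int \<Delta> \<or> sorted_minor r (col A) ?J = - int \<Delta>"
      by linarith
    moreover have "?J \<subseteq> {..<r+1} \<and> card ?J = r" using r by auto
    then have "sorted_minor r (col A) ?J
        \<in> {sorted_minor r (col A) J |J. J \<subseteq> {..<r + 1} \<and> card J = r}"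
      by blast
    ultimately show "\<exists>m\<in>{sorted_minor r (col A) J |J. J \<subseteq> {..<r + 1} \<and> card J = r}. m = int \<Delta> \<or> m = - int \<Delta>"
      by (rule bexI)
  qed
  moreover have "distinct (cols A)"
  proof -
    have v_neq: "v \<noteq> unit_vec r j" if "j < r" for j
    proof
      assume eq: "v = unit_vec r j"
      \<comment> \<open>A second index, available since \<open>r \<ge> 2\<close>, at which the unit
        vector vanishes and \<open>v\<close> does not.\<close>
      define l where "l = (if j = 0 then 1 else 0 :: nat)"
      have l: "l < r" "l \<noteq> j" using r by (auto simp: l_def)
      then have "v $ l = 0" unfolding eq using that by simp
      moreover have "v $ l \<noteq> 0" using l \<Delta> by (simp add: v_def)
      ultimately show False by simp
    qed
    have "inj_on c {0..<r+1}"
    proof (rule inj_onI)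
      fix i j assume ij: "i \<in> {0..<r+1}" "j \<in> {0..<r+1}" "c i = c j"
      then have le: "i \<le> r" "j \<le> r" by auto
      show "i = j"
      proof (cases "i < r")
        case True
        then have "j < r" using ij(3) le v_neq[OF True] by (cases "j < r") (auto simp: c_def)
        then show ?thesis using True ij(3) by (simp add: c_def)
      next
        case False
        then have "\<not> j < r" using ij(3) v_neq[of j] by (auto simp: c_def)
        then show ?thesis using False le by simp
      qed
    qed
    then have "distinct (map c [0..<r+1])" by (simp add: distinct_map del: upt_Suc)
    moreover have "cols A = map c [0..<r+1]"
      unfolding A_def using c_carrier by (intro cols_mat_of_cols) auto
    ultimately show ?thesis by simp
  qed
  ultimately show ?thesis
    unfolding generic_modular_col_numbers_def using A rank
    by (intro CollectI bexI[of _ A]) simp_all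
qed

lemma finite_generic_modular_col_numbers:
  assumes "r \<ge> 2" shows "finite (generic_modular_col_numbers \<Delta> r)"
proof -
  obtain p where "prime p" "\<Delta> < p" using bigger_prime by blast
  then have "generic_modular_col_numbers \<Delta> r \<subseteq> {..max r p + 1}"
    using generic_modular_card_le[OF _ _ assms] by blast
  then show ?thesis by (rule finite_subset) simp
qed

section \<open>Bertrand's postulate\<close>

text \<open>The reciprocals of \<open>k * (m choose k)\<close> form Leibniz's harmonic triangle.
  With \<open>a\<close>, \<open>b\<close>, \<open>c\<close> as in the induction step, 1/b = 1/c -
  1/a, so \<open>b\<close> divides every common multiple of \<open>a\<close> and
  \<open>c\<close>.\<close>

lemma mult_choose_dvd_Lcm:
  assumes "1 \<le> k" "k \<le> m"
  shows "k * (m choose k) dvd Lcm {1..m}"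
  using assms
proof (induction k arbitrary: m rule: nat_induct_at_least)
  case base
  then show ?case by (auto intro: dvd_Lcm)
next
  case (Suc k)
  define a b c where "a = k * (m choose k)" and "b = Suc k * (m choose Suc k)"
    and "c = k * ((m - 1) choose k)"
  have km: "Suc k \<le> m" "k \<ge> 1" using Suc by auto
  have aL: "a dvd Lcm {1..m}" unfolding a_def using Suc by (intro Suc.IH) auto
  have "c dvd Lcm {1..m-1}" unfolding c_def using Suc by (intro Suc.IH) auto
  also have "Lcm {1..m-1} dvd Lcm {1..m}" by (rule Lcm_subset) auto
  finally have cL: "c dvd Lcm {1..m}" .
  have pos: "a > 0" "c > 0" using km by (auto simp: a_def c_def zero_less_binomial_iff)
  have b: "b = (m - k) * (m choose k)"
    using binomial_absorb_comp[of m k] binomial_absorption[of k m] by (simp only: b_def)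
  have ac: "m * c = (m - k) * a"
    using binomial_absorb_comp[of m k] by (simp add: a_def c_def mult.left_commute mult.commute)
  have "k * b = (m - k) * a" by (simp add: a_def b mult_ac)
  then have kb: "k * b = m * c" using ac by simp
  have "m * (b * (int a - int c)) = m * (a * c)"
  proof -
    have "int m * (int b * (int a - int c)) = int b * (int m * int a - int (m * c))"
      by (simp add: algebra_simps)
    also have "\<dots> = int b * (int k * int a)"
      unfolding ac using km by (simp add: of_nat_diff algebra_simps)
    also have "\<dots> = int a * int (k * b)" by simp
    finally show ?thesis unfolding kb by (simp add: algebra_simps)
  qed
  then have key: "int b * (int a - int c) = int a * int c" using km by simp
  obtain a' where La: "Lcm {1..m} = a * a'" using aL by (rule dvdE)
  obtain c' where Lc: "Lcm {1..m} = c * c'" using cL by (rule dvdE)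
  have "int a * int c * int (Lcm {1..m}) = int a * int c * (int b * (int c' - int a'))"
  proof -
    have "int a * int c * (int b * (int c' - int a')) = int b * (int a * int (c * c') - int c * int (a * a'))"
      by (simp add: algebra_simps)
    also have "\<dots> = int b * (int a - int c) * int (Lcm {1..m})"
      unfolding La[symmetric] Lc[symmetric] by (simp add: algebra_simps)
    finally show ?thesis unfolding key by (rule sym)
  qed
  then have "int (Lcm {1..m}) = int b * (int c' - int a')"
    by (rule iffD1[OF mult_left_cancel, rotated]) (use pos in simp)
  then have "int b dvd int (Lcm {1..m})" by (rule dvdI)
  then show ?case by (simp only: b_def int_dvd_int_iff)
qed

lemma prime_power_dvd_Lcm:
  fixes p :: nat
  assumes "prime p" "finite A" "0 \<notin> A" "p ^ v dvd Lcm A" "v \<ge> 1"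
  shows "\<exists>x\<in>A. p ^ v dvd x"
  using assms(2-4)
proof (induction A rule: finite_induct)
  case empty
  then show ?case using assms(1,5) by (simp add: prime_nat_iff)
next
  case (insert x A)
  have nz: "x \<noteq> 0" "Lcm A \<noteq> 0" using insert by (auto simp: Lcm_0_iff_nat)
  have pu: "\<not> is_unit p" using assms(1) by (auto simp: prime_nat_iff)
  have "v \<le> multiplicity p (lcm x (Lcm A))"
    using insert.prems nz pu by (simp add: power_dvd_iff_le_multiplicity lcm_eq_0_iff)
  also have "multiplicity p (lcm x (Lcm A)) = max (multiplicity p x) (multiplicity p (Lcm A))"
    using nz assms(1) by (simp add: multiplicity_lcm)
  finally have "p ^ v dvd x \<or> p ^ v dvd Lcm A"
    by (auto simp: max_def intro: multiplicity_dvd' split: if_splits)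
  then show ?case using insert by auto
qed

text \<open>A substitute for Legendre's formula: the power divides \<open>Lcm {1..m}\<close>, hence
  a single number up to \<open>m\<close>.\<close>

lemma prime_power_dvd_choose_le:
  fixes p :: nat
  assumes p: "prime p" and dvd: "p ^ v dvd m choose k" and k: "1 \<le> k" "k \<le> m"
  shows "p ^ v \<le> m"
proof (cases "v = 0")
  case False
  have "p ^ v dvd k * (m choose k)" using dvd by simp
  then have "p ^ v dvd Lcm {1..m}" using mult_choose_dvd_Lcm[OF k] dvd_trans by blast
  then obtain x where "x \<in> {1..m}" "p ^ v dvd x"
    using prime_power_dvd_Lcm[OF p, of "{1..m}" v] False by auto
  then show ?thesis using dvd_imp_le[of "p ^ v" x] by auto
qed (use k in simp)

section \<open>The product of the primes up to a bound\<close>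

lemma prod_primes_dvd:
  fixes N :: nat
  assumes "finite P" "\<And>p. p \<in> P \<Longrightarrow> prime p \<and> p dvd N"
  shows "\<Prod>P dvd N"
  using assms
proof (induction P rule: finite_induct)
  case (insert p P)
  have "coprime p (\<Prod>P)"
    using insert by (intro prod_coprime_right primes_coprime) auto
  then show ?case using insert by (simp add: divides_mult)
qed simp

lemma choose_odd_le: "(2 * m + 1 choose m) \<le> 4 ^ m"
proof -
  have "(2 * m + 1 choose m) + (2 * m + 1 choose (m + 1)) = (\<Sum>k\<in>{m, m+1}. 2 * m + 1 choose k)" by simp
  also have "\<dots> \<le> (\<Sum>k\<le>2*m+1. 2 * m + 1 choose k)" by (intro sum_mono2) auto
  also have "\<dots> = 2 ^ (2 * m + 1)" by (rule choose_row_sum)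
  also have "\<dots> = 2 * 4 ^ m" by (simp add: power_mult)
  finally show ?thesis
    using binomial_symmetric[of m "2 * m + 1"] by simp
qed

text \<open>An even \<open>n > 2\<close> is not prime. For \<open>n = 2 * m + 1\<close> the primes
  above \<open>m + 1\<close> all divide \<open>n choose m\<close>, which is at most
  \<open>4 ^ m\<close>, and the others are covered by induction at \<open>m + 1\<close>.\<close>

lemma prod_primes_le: "(\<Prod>{p. prime p \<and> p \<le> n}) \<le> (4 :: nat) ^ n"
proof (induction n rule: less_induct)
  case (less n)
  have fin: "finite {p. prime p \<and> p \<le> k}" for k :: nat by (rule finite_subset[of _ "{..k}"]) auto
  consider "n < 2" | "n = 2" | "n > 2" "even n" | "n > 2" "odd n" by linarith
  then show ?case
  proof cases
    case 1
    then have "{p. prime p \<and> p \<le> n} = {}" by (auto dest: prime_ge_2_nat)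
    then show ?thesis by (simp only: prod.empty) simp
  next
    case 2
    then have "{p. prime p \<and> p \<le> n} = {2}" by (auto dest: prime_ge_2_nat intro: le_antisym)
    then show ?thesis using 2 by simp
  next
    case 3
    have "p \<le> n \<longleftrightarrow> p \<le> n - 1" if "prime p" for p
    proof -
      have "p \<noteq> n" using prime_odd_nat[OF that] 3 by blast
      then show ?thesis by linarith
    qed
    then have "{p. prime p \<and> p \<le> n} = {p. prime p \<and> p \<le> n - 1}" by blast
    then have "\<Prod>{p. prime p \<and> p \<le> n} \<le> 4 ^ (n - 1)" using less[of "n - 1"] 3 by simp
    also have "\<dots> \<le> 4 ^ n" by (rule power_increasing) auto
    finally show ?thesis .
  next
    case 4
    then obtain m where m: "n = 2 * m + 1" "m \<ge> 1" by (auto elim!: oddE)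
    let ?P = "{p. prime p \<and> p \<le> m + 1}" and ?Q = "{p. prime p \<and> m + 1 < p \<and> p \<le> n}"
    have "{p. prime p \<and> p \<le> n} = ?P \<union> ?Q" using m by auto
    moreover have "finite ?Q" by (rule finite_subset[OF _ fin[of n]]) auto
    moreover have "?P \<inter> ?Q = {}" by auto
    ultimately have eq: "\<Prod>{p. prime p \<and> p \<le> n} = \<Prod>?P * \<Prod>?Q"
      using fin[of "m + 1"] by (simp add: prod.union_disjoint)
    have "\<Prod>?Q dvd n choose m"
    proof (rule prod_primes_dvd[OF \<open>finite ?Q\<close>])
      fix p assume p: "p \<in> ?Q"
      have "p dvd fact n" using p by (auto simp: prime_dvd_fact_iff)
      also have "fact n = fact m * fact (n - m) * (n choose m)"
        using binomial_fact_lemma[of m n] m by simp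
      finally have "p dvd fact m * fact (n - m) * (n choose m)" .
      moreover have "\<not> p dvd fact m" "\<not> p dvd fact (n - m)"
        using p m prime_dvd_fact_iff[of p m] prime_dvd_fact_iff[of p "n - m"] by auto
      ultimately show "prime p \<and> p dvd n choose m" using p by (auto simp: prime_dvd_mult_iff)
    qed
    then have "\<Prod>?Q \<le> n choose m" using m by (intro dvd_imp_le) (auto simp: zero_less_binomial_iff)
    also have "\<dots> \<le> 4 ^ m" using choose_odd_le[of m] m by simp
    finally have "\<Prod>?P * \<Prod>?Q \<le> 4 ^ (m + 1) * 4 ^ m"
      using less[of "m + 1"] m by (intro mult_mono) auto
    also have "\<dots> = 4 ^ n" using m by (simp flip: power_add)
    finally show ?thesis unfolding eq .
  qed
qed

text \<open>Below \<open>p ^ 2\<close> no factor contains \<open>p\<close> twice, so only the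
  multiples of \<open>p\<close> are counted.\<close>

lemma multiplicity_fact_small:
  fixes p :: nat
  assumes p: "prime p" and "m < p ^ 2"
  shows "multiplicity p (fact m) = m div p"
  using assms(2)
proof (induction m)
  case (Suc m)
  have p2: "p \<ge> 2" using p prime_ge_2_nat by blast
  have "multiplicity p (Suc m) = (if p dvd Suc m then 1 else 0)"
  proof (cases "p dvd Suc m")
    case True
    have "\<not> p ^ 2 dvd Suc m" using Suc.prems dvd_imp_le[of "p ^ 2" "Suc m"] by auto
    then show ?thesis using True multiplicity_eqI[of p 1 "Suc m"] by (simp add: numeral_2_eq_2)
  qed (simp add: not_dvd_imp_multiplicity_0)
  moreover have "Suc m div p = m div p + (if p dvd Suc m then 1 else 0)"
    by (simp add: div_Suc dvd_eq_mod_eq_0)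
  ultimately show ?case
    using Suc p prime_elem_multiplicity_mult_distrib[of p "Suc m" "fact m"] by simp
qed (use p in simp)

text \<open>Here \<open>p\<close> occurs exactly twice in \<open>fact (2 * n)\<close>, from
  \<open>p\<close> and \<open>2 * p\<close>, and once in each of the two factors
  \<open>fact n\<close>.\<close>

lemma prime_not_dvd_central_choose:
  fixes p :: nat
  assumes p: "prime p" "2 < p" "p \<le> n" "2 * n < 3 * p"
  shows "\<not> p dvd 2 * n choose n"
proof -
  have "3 * p \<le> p ^ 2" using p by (simp add: power2_eq_square)
  then have sq: "2 * n < p ^ 2" "n < p ^ 2" using p by linarith+
  have "multiplicity p (fact (2 * n)) = multiplicity p (fact n * fact n * (2 * n choose n))"
    using binomial_fact_lemma[of n "2 * n"] by simp
  also have "\<dots> = 2 * multiplicity p (fact n) + multiplicity p (2 * n choose n)"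
    using p by (simp add: prime_elem_multiplicity_mult_distrib)
  finally have "2 * n div p = 2 * (n div p) + multiplicity p (2 * n choose n)"
    using multiplicity_fact_small[OF p(1)] sq by simp
  moreover have "2 * n div p = 2" "n div p = 1"
    using p by (auto intro!: div_nat_eqI)
  ultimately have "multiplicity p (2 * n choose n) = 0" by simp
  then show ?thesis using p by (simp add: multiplicity_eq_zero_iff)
qed

text \<open>From 31 on, consecutive numbers have ratio at most 32/31, whose sixth power is below 2.
  The exponent 6 is that of \<open>(x + 1) ^ 6\<close> at the end of the estimate for Bertrand's
  postulate.\<close>

lemma pow6_le: "n \<ge> 31 \<Longrightarrow> n ^ 6 \<le> (2 :: nat) ^ (n - 1)"
proof (induction n rule: nat_induct_at_least)
  case (Suc n)
  have "31 * Suc n \<le> 32 * n" using Suc by simp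
  then have "(31 * Suc n) ^ 6 \<le> (32 * n) ^ 6" by (rule power_mono) simp
  then have "31 ^ 6 * Suc n ^ 6 \<le> 32 ^ 6 * n ^ 6" by (simp only: power_mult_distrib)
  then have "Suc n ^ 6 \<le> 2 * n ^ 6" by simp
  also have "\<dots> \<le> 2 * 2 ^ (n - 1)" using Suc by simp
  also have "\<dots> = 2 ^ (Suc n - 1)" using Suc by (simp flip: power_Suc)
  finally show ?case .
qed simp

text \<open>Erdos' argument. Without primes in the interval, the prime factors of the central binomial
  coefficient are at most \<open>2n/3\<close>, and those above \<open>\<surd>(2n)\<close> occur only once.\<close>

lemma bertrand_large:
  fixes n :: nat
  assumes n: "n \<ge> 450"
  shows "\<exists>p. prime p \<and> n < p \<and> p < 2 * n"
proof (rule ccontr)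
  assume none: "\<not> (\<exists>p. prime p \<and> n < p \<and> p < 2 * n)"
  define C where "C = (2 * n choose n)"
  have "\<exists>x. x ^ 2 \<le> 2 * n \<and> 2 * n < (x + 1) ^ 2"
  proof -
    define y where "y = (LEAST y. 2 * n < y ^ 2)"
    have ex: "2 * n < (2 * n + 1) ^ 2" by (simp add: power2_eq_square)
    have y: "2 * n < y ^ 2" unfolding y_def by (rule LeastI[of _ "2 * n + 1"]) (rule ex)
    then have "y \<noteq> 0" by (intro notI) simp
    then have "\<not> 2 * n < (y - 1) ^ 2" unfolding y_def by (intro not_less_Least) simp
    then show ?thesis using y \<open>y \<noteq> 0\<close> by (intro exI[of _ "y - 1"]) simp
  qed
  then obtain x where x: "x ^ 2 \<le> 2 * n" "2 * n < (x + 1) ^ 2" by blast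
  \<comment> \<open>The bound 450 is half of \<open>30 ^ 2\<close>: it brings \<open>x + 1\<close>
    into the range of \<open>pow6_le\<close>.\<close>
  have x30: "x \<ge> 30"
  proof (rule ccontr)
    assume "\<not> x \<ge> 30"
    then have "(x + 1) ^ 2 \<le> 30 ^ 2" by (intro power_mono) auto
    then show False using x(2) n by simp
  qed
  define P where "P = prime_factors C"
  have C0: "C \<noteq> 0" by (simp add: C_def)
  have finP: "finite P" by (simp add: P_def)
  have P: "prime p \<and> 3 * p \<le> 2 * n" if "p \<in> P" for p
  proof -
    have p: "prime p" "p dvd C" using that by (auto simp: P_def)
    have "p ^ 1 \<le> 2 * n" using p n by (intro prime_power_dvd_choose_le[of p _ _ n]) (auto simp: C_def)
    moreover have "p \<noteq> 2 * n" using p prime_product[of 2 n] n by auto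
    ultimately have "p < 2 * n" by simp
    then have "p \<le> n" using none p(1) linorder_not_less by blast
    moreover have "\<not> (2 < p \<and> p \<le> n \<and> 2 * n < 3 * p)"
      using prime_not_dvd_central_choose[of p n] p by (auto simp: C_def)
    ultimately show ?thesis using p n by linarith
  qed
  have power_le: "p ^ multiplicity p C \<le> 2 * n" if "p \<in> P" for p
    using P[OF that] n by (intro prime_power_dvd_choose_le[of p _ _ n]) (auto simp: C_def multiplicity_dvd)
  let ?S = "{p\<in>P. p \<le> x}" and ?B = "{p\<in>P. x < p}"
  have "C = (\<Prod>p\<in>P. p ^ multiplicity p C)"
    using C0 prime_factorization_nat[of C] by (simp add: P_def)
  also have "P = ?S \<union> ?B" by auto
  also have "(\<Prod>p\<in>?S \<union> ?B. p ^ multiplicity p C)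
      = (\<Prod>p\<in>?S. p ^ multiplicity p C) * (\<Prod>p\<in>?B. p ^ multiplicity p C)"
    using finP by (intro prod.union_disjoint) auto
  also have "\<dots> \<le> (2 * n) ^ (x - 1) * 4 ^ (2 * n div 3)"
  proof (rule mult_mono)
    have "(\<Prod>p\<in>?S. p ^ multiplicity p C) \<le> (\<Prod>p\<in>?S. 2 * n)"
      using power_le by (intro prod_mono) auto
    also have "\<dots> = (2 * n) ^ card ?S" by simp
    also have "\<dots> \<le> (2 * n) ^ (x - 1)"
    proof (rule power_increasing)
      have "?S \<subseteq> {2..x}" using P prime_ge_2_nat by auto
      then show "card ?S \<le> x - 1" using card_mono[of "{2..x}" ?S] by simp
    qed (use n in simp)
    finally show "(\<Prod>p\<in>?S. p ^ multiplicity p C) \<le> (2 * n) ^ (x - 1)" .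
    have "(\<Prod>p\<in>?B. p ^ multiplicity p C) \<le> (\<Prod>p\<in>?B. p)"
    proof (intro prod_mono conjI)
      fix p assume p: "p \<in> ?B"
      have "multiplicity p C \<le> 1"
      proof (rule ccontr)
        assume "\<not> multiplicity p C \<le> 1"
        then have "p ^ 2 \<le> p ^ multiplicity p C"
          using p by (intro power_increasing) auto
        moreover have "(x + 1) ^ 2 \<le> p ^ 2" using p by (intro power_mono) auto
        moreover have "p ^ multiplicity p C \<le> 2 * n" using power_le p by blast
        ultimately show False using x(2) by linarith
      qed
      then have "p ^ multiplicity p C \<le> p ^ 1" using p by (intro power_increasing) auto
      then show "p ^ multiplicity p C \<le> p" by simp
    qed auto
    also have "\<dots> \<le> \<Prod>{p. prime p \<and> p \<le> 2 * n div 3}"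
    proof (rule dvd_imp_le)
      have "finite {p. prime p \<and> p \<le> 2 * n div 3}"
        by (rule finite_subset[of _ "{..2 * n div 3}"]) auto
      moreover have "?B \<subseteq> {p. prime p \<and> p \<le> 2 * n div 3}" using P by fastforce
      ultimately show "\<Prod>?B dvd \<Prod>{p. prime p \<and> p \<le> 2 * n div 3}" by (rule prod_dvd_prod_subset)
    qed (auto intro!: prod_pos prime_gt_0_nat)
    also have "\<dots> \<le> 4 ^ (2 * n div 3)" by (rule prod_primes_le)
    finally show "(\<Prod>p\<in>?B. p ^ multiplicity p C) \<le> 4 ^ (2 * n div 3)" .
  qed auto
  finally have C_le: "C \<le> (2 * n) ^ (x - 1) * 4 ^ (2 * n div 3)" .
  have "real (4 ^ n) \<le> real (C * (2 * n))"
    using central_binomial_lower_bound[of n] n by (simp add: C_def field_simps)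
  then have "4 ^ n \<le> C * (2 * n)" by (simp only: of_nat_le_iff)
  \<comment> \<open>The small primes contribute at most \<open>x - 1\<close> factors
    \<open>2 * n\<close>; the lower bound for the central coefficient adds one more.\<close>
  also have "\<dots> \<le> (2 * n) ^ (x - 1) * 4 ^ (2 * n div 3) * (2 * n)"
    using C_le by (rule mult_right_mono) simp
  also have "\<dots> = (2 * n) ^ x * 4 ^ (2 * n div 3)"
    using x30 power_minus_mult[of x "2 * n"] by (simp add: mult_ac)
  \<comment> \<open>Cubing removes the rounding in \<open>2 * n div 3\<close>.\<close>
  finally have "(4 ^ n) ^ 3 \<le> ((2 * n) ^ x * 4 ^ (2 * n div 3)) ^ 3" by (rule power_mono) simp
  also have "\<dots> = (2 * n) ^ (3 * x) * 4 ^ (2 * n div 3 * 3)"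
    by (simp add: power_mult_distrib mult.commute flip: power_mult)
  also have "\<dots> \<le> (2 * n) ^ (3 * x) * 4 ^ (2 * n)"
    by (intro mult_left_mono power_increasing) auto
  finally have "4 ^ n * 4 ^ (2 * n) \<le> (2 * n) ^ (3 * x) * 4 ^ (2 * n)"
    by (simp flip: power_mult power_add add: mult.commute)
  then have "4 ^ n \<le> (2 * n) ^ (3 * x)" by simp
  also have "\<dots> < ((x + 1) ^ 2) ^ (3 * x)"
    using x x30 by (intro power_strict_mono) auto
  also have "\<dots> = ((x + 1) ^ 6) ^ x" by (simp flip: power_mult)
  also have "\<dots> \<le> (2 ^ (x + 1 - 1)) ^ x" using x30 by (intro power_mono pow6_le) auto
  also have "\<dots> = 2 ^ (x ^ 2)" by (simp add: power2_eq_square flip: power_mult)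
  also have "\<dots> \<le> 2 ^ (2 * n)" using x by (intro power_increasing) auto
  also have "\<dots> = 4 ^ n" by (simp add: power_mult)
  finally show False by simp
qed

theorem bertrand:
  assumes "n \<ge> (2 :: nat)"
  shows "\<exists>p. prime p \<and> n < p \<and> p < 2 * n"
proof (cases "n \<ge> 450")
  case False
  define Q where "Q \<longleftrightarrow> (\<exists>p. prime p \<and> n < p \<and> p < 2 * n)"
  have step: "Q" if "prime q" "n < q" "q < 2 * n" for q
    unfolding Q_def using that by blast
  \<comment> \<open>Each prime in this chain is less than twice its predecessor, so it lies below
    \<open>2 * n\<close> as soon as \<open>n\<close> reaches the predecessor. The last prime exceeds
    450.\<close>
  have "n < 3 \<Longrightarrow> Q" by (rule step[of 3]) (use assms in simp_all)
  moreover have "\<not> n < 3 \<Longrightarrow> n < 5 \<Longrightarrow> Q" by (rule step[of 5]) (use assms in simp_all)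
  moreover have "\<not> n < 5 \<Longrightarrow> n < 7 \<Longrightarrow> Q" by (rule step[of 7]) (use assms in simp_all)
  moreover have "\<not> n < 7 \<Longrightarrow> n < 13 \<Longrightarrow> Q" by (rule step[of 13]) (use assms in simp_all)
  moreover have "\<not> n < 13 \<Longrightarrow> n < 23 \<Longrightarrow> Q" by (rule step[of 23]) (use assms in simp_all)
  moreover have "\<not> n < 23 \<Longrightarrow> n < 43 \<Longrightarrow> Q" by (rule step[of 43]) (use assms in simp_all)
  moreover have "\<not> n < 43 \<Longrightarrow> n < 83 \<Longrightarrow> Q" by (rule step[of 83]) (use assms in simp_all)
  moreover have "\<not> n < 83 \<Longrightarrow> n < 163 \<Longrightarrow> Q" by (rule step[of 163]) (use assms in simp_all)
  moreover have "\<not> n < 163 \<Longrightarrow> n < 317 \<Longrightarrow> Q" by (rule step[of 317]) (use assms in simp_all)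
  moreover have "\<not> n < 317 \<Longrightarrow> n < 631 \<Longrightarrow> Q" by (rule step[of 631]) (use assms in simp_all)
  moreover have "n < 631" using False by simp
  ultimately have Q by blast
  then show ?thesis unfolding Q_def .
qed (rule bertrand_large)

section \<open>The column number\<close>

theorem theorem1p3:
  fixes r \<Delta> p :: nat
  assumes "r \<ge> 2" and "\<Delta> \<ge> 1"
    and "p = (LEAST q. prime q \<and> \<Delta> < q)"
  shows "g \<Delta> r \<le> max r p + 1
    \<and> (\<Delta> \<ge> 2 \<and> r \<le> 2 * \<Delta> - 1 \<longrightarrow> g \<Delta> r \<le> 2 * \<Delta>)
    \<and> (r \<ge> 2 * \<Delta> - 1 \<longrightarrow> g \<Delta> r = r + 1)"
proof -
  let ?N = "generic_modular_col_numbers \<Delta> r"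
  have p: "prime p \<and> \<Delta> < p"
    unfolding assms(3) using bigger_prime[of \<Delta>] by (rule LeastI_ex)
  have fin: "finite ?N" by (rule finite_generic_modular_col_numbers[OF assms(1)])
  have mem: "r + 1 \<in> ?N" by (rule generic_modular_exists[OF assms(1,2)])
  have g: "g \<Delta> r \<le> max r p + 1"
    unfolding g_def using fin mem generic_modular_card_le[OF _ _ assms(1)] p
    by (subst Max_le_iff) auto
  have lower: "r + 1 \<le> g \<Delta> r" unfolding g_def by (rule Max_ge[OF fin mem])
  \<comment> \<open>The strict upper end in Bertrand's postulate gives
    \<open>2 * \<Delta> - 1\<close>, the same threshold that separates the two ranges of
    \<open>r\<close>.\<close>
  have p_le: "p \<le> 2 * \<Delta> - 1" if two: "\<Delta> \<ge> 2"
  proof -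
    obtain q where "prime q" "\<Delta> < q" "q < 2 * \<Delta>" using bertrand[OF two] by blast
    moreover from this have "p \<le> q" unfolding assms(3) by (intro Least_le) simp
    ultimately show ?thesis by simp
  qed
  \<comment> \<open>For \<Delta> = 1, outside the range of \<open>bertrand\<close>, the prime is 2
    and still at most \<open>r\<close>.\<close>
  have "p = 2" if "\<not> \<Delta> \<ge> 2"
  proof -
    have "p \<le> 2" unfolding assms(3) using that by (intro Least_le) simp
    then show ?thesis using prime_ge_2_nat p by (intro le_antisym) auto
  qed
  then have "p \<le> r" if "r \<ge> 2 * \<Delta> - 1" using p_le that assms(1) by linarith
  then have "r \<ge> 2 * \<Delta> - 1 \<Longrightarrow> g \<Delta> r = r + 1" using g lower by simp
  moreover have "g \<Delta> r \<le> 2 * \<Delta>" if "\<Delta> \<ge> 2" "r \<le> 2 * \<Delta> - 1"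
    using g p_le[OF that(1)] that by linarith
  ultimately show ?thesis using g by blast
qed

end
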